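(* Let $\Gamma$ be an EAFC system with finite vertex set, $g\in G_\Gamma$ and $n\in\mathbb{Z}\setminus\{0\}$. Then $P(g)=P(g^n)$.
   Context: An Artin–Tits system $\Gamma=((V,E),m)$ consists of a simplicial graph $(V,E)$ and a labelling $m\colon E\to\{2,3,\dots\}$; the Artin–Tits group is $G_\Gamma=\langle V \mid \mathrm{prod}(u,v,m(\{u,v\}))=\mathrm{prod}(v,u,m(\{u,v\}))\ \forall \{u,v\}\in E\rangle$, where $\mathrm{prod}(u,v,n)$ is the prefix of length $n$ of $uvuv\cdots$. An EAFC system is one with all labels even and such that among any three pairwise adjacent vertices at least two of the three edges have label $2$. For $S\subseteq V$, $G_S=\langle S\rangle\leqslant G_\Gamma$ is a standard parabolic subgroup; a parabolic subgroup is a conjugate $gG_Sg^{-1}$ of a standard parabolic subgroup. For $Y\subseteq G_\Gamma$, the parabolic closure $P(Y)$ is the intersection of all parabolic subgroups of $G_\Gamma$ containing $Y$; for $g\in G_\Gamma$, $P(g)=P(\{g\})$. (For finite EAFC systems an intersection of parabolic subgroups is again parabolic, so $P(Y)$ is parabolic.) *)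

theory Defs
  imports "HOL-Algebra.Group"
begin

text \<open>Words over the vertex set: a letter (x, True) is the generator x,
  a letter (x, False) is its inverse.\<close>
type_synonym 'v word = "('v \<times> bool) list"

definition words :: "'v set \<Rightarrow> 'v word set" where
  "words S = {w. \<forall>p\<in>set w. fst p \<in> S}"

definition prodw :: "'v \<Rightarrow> 'v \<Rightarrow> nat \<Rightarrow> 'v word" where
  "prodw u v n = map (\<lambda>i. (if even i then u else v, True)) [0..<n]"

definition artin_system :: "'v set \<Rightarrow> 'v set set \<Rightarrow> ('v set \<Rightarrow> nat) \<Rightarrow> bool" where
  "artin_system V E m \<longleftrightarrow>
     (\<forall>e\<in>E. \<exists>u v. u \<in> V \<and> v \<in> V \<and> u \<noteq> v \<and> e = {u, v}) \<and>
     (\<forall>e\<in>E. 2 \<le> m e)"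

definition eafc_system :: "'v set \<Rightarrow> 'v set set \<Rightarrow> ('v set \<Rightarrow> nat) \<Rightarrow> bool" where
  "eafc_system V E m \<longleftrightarrow> artin_system V E m \<and>
     (\<forall>e\<in>E. even (m e)) \<and>
     (\<forall>u v w. {u, v} \<in> E \<and> {v, w} \<in> E \<and> {u, w} \<in> E \<longrightarrow>
        (m {u, v} = 2 \<and> m {v, w} = 2) \<or> (m {u, v} = 2 \<and> m {u, w} = 2) \<or>
        (m {v, w} = 2 \<and> m {u, w} = 2))"

inductive artin_step :: "'v set \<Rightarrow> 'v set set \<Rightarrow> ('v set \<Rightarrow> nat) \<Rightarrow> 'v word \<Rightarrow> 'v word \<Rightarrow> bool"
  for V E m where
  cancel: "x \<in> V \<Longrightarrow> artin_step V E m (a @ [(x, b), (x, \<not> b)] @ c) (a @ c)"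
| braid: "{u, v} \<in> E \<Longrightarrow>
    artin_step V E m (a @ prodw u v (m {u, v}) @ c) (a @ prodw v u (m {u, v}) @ c)"

definition artin_eq :: "'v set \<Rightarrow> 'v set set \<Rightarrow> ('v set \<Rightarrow> nat) \<Rightarrow> 'v word \<Rightarrow> 'v word \<Rightarrow> bool" where
  "artin_eq V E m = equivclp (artin_step V E m)"

definition artin_class :: "'v set \<Rightarrow> 'v set set \<Rightarrow> ('v set \<Rightarrow> nat) \<Rightarrow> 'v word \<Rightarrow> 'v word set" where
  "artin_class V E m w = {w'. artin_eq V E m w w'}"

definition artin_group :: "'v set \<Rightarrow> 'v set set \<Rightarrow> ('v set \<Rightarrow> nat) \<Rightarrow> 'v word set monoid" where
  "artin_group V E m =
     \<lparr> carrier = artin_class V E m ` words V,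
       mult = (\<lambda>A B. artin_class V E m ((SOME a. a \<in> A) @ (SOME b. b \<in> B))),
       one = artin_class V E m [] \<rparr>"

definition std_parabolic :: "'v set \<Rightarrow> 'v set set \<Rightarrow> ('v set \<Rightarrow> nat) \<Rightarrow> 'v set \<Rightarrow> 'v word set set" where
  "std_parabolic V E m S = artin_class V E m ` words S"

definition parabolic :: "'v set \<Rightarrow> 'v set set \<Rightarrow> ('v set \<Rightarrow> nat) \<Rightarrow> 'v word set set \<Rightarrow> bool" where
  "parabolic V E m H \<longleftrightarrow>
     (\<exists>S g. S \<subseteq> V \<and> g \<in> carrier (artin_group V E m) \<and>
        H = (\<lambda>h. g \<otimes>\<^bsub>artin_group V E m\<^esub> h \<otimes>\<^bsub>artin_group V E m\<^esub> inv\<^bsub>artin_group V E m\<^esub> g)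
              ` std_parabolic V E m S)"

definition parabolic_closure :: "'v set \<Rightarrow> 'v set set \<Rightarrow> ('v set \<Rightarrow> nat) \<Rightarrow> 'v word set set \<Rightarrow> 'v word set set" where
  "parabolic_closure V E m Y = \<Inter> {H. parabolic V E m H \<and> Y \<subseteq> H}"

end

theory Submission
  imports Defs "HOL-Algebra.Generated_Groups" "HOL-Algebra.Elementary_Groups"
begin

text \<open>
  It suffices that every standard parabolic subgroup is closed under taking roots. Removing the
  vertices one at a time, consider a vertex \<open>v\<close> with link \<open>L\<close>: the group on \<open>S\<close> is the amalgam of the
  groups on \<open>S - {v}\<close> and on the star \<open>insert v L\<close> over the group on \<open>L\<close>, and in an amalgam a factor
  is root-closed as soon as the amalgamated subgroup is root-closed in both factors (normal forms).

  In the star, a root of an element of the group on \<open>L\<close> has \<open>v\<close>-degree zero. By the EAFC condition the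
  elements of \<open>v\<close>-degree zero form again an EAFC Artin group, in which each \<open>t \<in> L\<close> is replaced by
  \<open>m {v, t} div 2\<close> copies, namely the conjugates of \<open>t\<close> by the powers of \<open>v\<close>. A vertex with more than one
  copy commutes with all its neighbours in \<open>L\<close>, so the extra copies can be removed one at a time, again
  as amalgams over links contained in \<open>L\<close>.
\<close>

section \<open>Artin groups\<close>

text \<open>The star needs its own argument because the amalgam says nothing when \<open>v\<close>
  is joined to every other vertex of \<open>S\<close>. Put k = \<open>m {v, t} div 2\<close> and c_j
  = v^j t v^-j. Then (v t)^k = c_1 ... c_k v^k and (t v)^k = c_0 ... c_{k-1} v^k, so the relation
  between v and t amounts to c_1 ... c_{k-1} c_k = c_0 c_1 ... c_{k-1}. It computes c_k from c_0,
  ..., c_{k-1} and imposes nothing on these: hence k copies, permuted up to conjugation by an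
  automorphism that plays the role of v. The star group is the semidirect product of the group on
  the copies with the integers. Instead of an isomorphism, two maps are built: \<open>emb\<close>
  from the group on the copies into the Artin group, and a permutation representation in the
  opposite direction that recovers the element of the copy group. The uniqueness of normal forms in
  amalgams is obtained by the same device, an action on the prospective normal forms. Evenness of
  the labels supplies the retractions and the exponent sums.\<close>

definition (in monoid) word_eval :: "('v \<Rightarrow> 'a) \<Rightarrow> 'v word \<Rightarrow> 'a" where
  "word_eval f w = foldr (\<lambda>(x, b) q. (if b then f x else inv f x) \<otimes> q) w \<one>"

lemma (in monoid) word_eval_simps [simp]:
  "word_eval f [] = \<one>"
  "word_eval f ((x, b) # w) = (if b then f x else inv f x) \<otimes> word_eval f w"
  by (simp_all add: word_eval_def)

context group
begin

lemma word_eval_closed: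
  assumes "\<And>x. x \<in> fst ` set w \<Longrightarrow> f x \<in> carrier G"
  shows "word_eval f w \<in> carrier G"
  using assms by (induction w) auto

lemma word_eval_append:
  assumes "\<And>x. f x \<in> carrier G"
  shows "word_eval f (w @ w') = word_eval f w \<otimes> word_eval f w'"
proof (induction w)
  case Nil
  then show ?case by (simp add: word_eval_closed assms)
next
  case (Cons p w)
  obtain x b where p: "p = (x, b)" by force
  show ?case using Cons by (simp add: p m_assoc word_eval_closed assms)
qed

lemma word_eval_prodw:
  assumes "\<And>x. f x \<in> carrier G"
  shows "word_eval f (prodw u v (2 * k)) = (f u \<otimes> f v) [^] k"
proof (induction k)
  case (Suc k)
  have "prodw u v (2 * Suc k) = prodw u v (2 * k) @ [(u, True), (v, True)]"
    by (simp add: prodw_def)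
  then show ?case
    using Suc by (simp add: word_eval_append assms)
qed (simp add: prodw_def)

lemma pow_conj:
  assumes "x \<in> carrier G" "y \<in> carrier G"
  shows "(x \<otimes> y \<otimes> inv x) [^] (n::nat) = x \<otimes> y [^] n \<otimes> inv x"
proof (induction n)
  case (Suc n)
  have "inv x \<otimes> (x \<otimes> (y \<otimes> inv x)) = y \<otimes> inv x"
    using assms by (simp add: m_assoc[symmetric])
  then show ?case using Suc assms by (simp add: m_assoc)
qed (use assms in simp)

lemma subgroup_conj_image:
  assumes "x \<in> carrier G" "y \<in> carrier G" "H \<subseteq> carrier G"
  shows "y \<in> (\<lambda>h. x \<otimes> h \<otimes> inv x) ` H \<longleftrightarrow> inv x \<otimes> y \<otimes> x \<in> H"
proof
  assume "y \<in> (\<lambda>h. x \<otimes> h \<otimes> inv x) ` H"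
  then obtain h where h: "h \<in> H" "y = x \<otimes> h \<otimes> inv x" by auto
  then have "h \<in> carrier G" using assms by auto
  moreover have "inv x \<otimes> (x \<otimes> h) = h"
    using calculation assms by (simp add: m_assoc[symmetric])
  ultimately show "inv x \<otimes> y \<otimes> x \<in> H" using h assms by (simp add: m_assoc)
next
  assume a: "inv x \<otimes> y \<otimes> x \<in> H"
  have "x \<otimes> (inv x \<otimes> y) = y"
    using assms by (simp add: m_assoc[symmetric])
  then have "y = x \<otimes> (inv x \<otimes> y \<otimes> x) \<otimes> inv x" using assms by (simp add: m_assoc)
  with a show "y \<in> (\<lambda>h. x \<otimes> h \<otimes> inv x) ` H" by blast
qed

end

lemma hom_eq_on_generate:
  assumes "group G" "group H" "f \<in> hom G H" "g \<in> hom G H" "S \<subseteq> carrier G"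
    "\<And>s. s \<in> S \<Longrightarrow> f s = g s" and x: "x \<in> generate G S"
  shows "f x = g x"
proof -
  interpret G: group G by fact
  interpret f: group_hom G H f using assms by (simp add: group_hom_def group_hom_axioms_def)
  interpret g: group_hom G H g using assms by (simp add: group_hom_def group_hom_axioms_def)
  show ?thesis using x
  proof (induction)
    case (inv h) then show ?case using assms(5,6) by (metis f.hom_inv g.hom_inv subsetD)
  next
    case (eng h1 h2)
    then show ?case using G.generate_in_carrier[OF assms(5)] by simp
  qed (use assms in auto)
qed

lemma generate_subset_closed:
  assumes "group G" "group H" "f \<in> hom G H" "S \<subseteq> carrier G" "subgroup K H"
    "\<And>s. s \<in> S \<Longrightarrow> f s \<in> K" and x: "x \<in> generate G S"
  shows "f x \<in> K"
proof -
  interpret G: group G by fact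
  interpret f: group_hom G H f using assms by (simp add: group_hom_def group_hom_axioms_def)
  show ?thesis using x
  proof (induction)
    case (inv h) then show ?case using assms(4-6) by (metis f.hom_inv subgroup.m_inv_closed subsetD)
  next
    case (eng h1 h2)
    then show ?case using G.generate_in_carrier[OF assms(4)] assms(5)
      by (simp add: subgroup.m_closed)
  qed (use assms in \<open>auto simp: subgroup.one_closed\<close>)
qed

section \<open>Words modulo the Artin relations, and parabolic subgroups as generated
  subgroups\<close>

locale artin =
  fixes V :: "'v set" and E :: "'v set set" and m :: "'v set \<Rightarrow> nat"
  assumes sys: "artin_system V E m"
begin

abbreviation cls where "cls \<equiv> artin_class V E m"
abbreviation AG where "AG \<equiv> artin_group V E m"

definition gen :: "'v \<Rightarrow> 'v word set" where "gen x = cls [(x, True)]"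

lemma edge_in: "{u, v} \<in> E \<Longrightarrow> u \<in> V \<and> v \<in> V \<and> u \<noteq> v"
  using sys unfolding artin_system_def by (metis doubleton_eq_iff)

lemma cls_eq_iff: "cls w = cls w' \<longleftrightarrow> artin_eq V E m w w'"
  unfolding artin_class_def artin_eq_def
  by (metis (no_types, lifting) equivclp_refl equivclp_sym equivclp_trans mem_Collect_eq subsetI subset_antisym)

lemma artin_step_context:
  "artin_step V E m w w' \<Longrightarrow> artin_step V E m (a @ w @ c) (a @ w' @ c)"
proof (induction rule: artin_step.induct)
  case (cancel x p b q)
  then show ?case using artin_step.cancel[OF cancel, where a = "a @ p" and b = b and c = "q @ c"] by simp
next
  case (braid u v p q)
  then show ?case using artin_step.braid[OF braid, where a = "a @ p" and c = "q @ c"] by simp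
qed

lemma artin_eq_context:
  "artin_eq V E m w w' \<Longrightarrow> artin_eq V E m (a @ w @ c) (a @ w' @ c)"
  unfolding artin_eq_def
proof (induction rule: equivclp_induct)
  case (step y z)
  then show ?case using artin_step_context[of y z a c] artin_step_context[of z y a c]
    by (meson equivclp_into_equivclp)
qed simp

lemma artin_eq_append:
  "artin_eq V E m a a' \<Longrightarrow> artin_eq V E m b b' \<Longrightarrow> artin_eq V E m (a @ b) (a' @ b')"
  using artin_eq_context[of a a' "[]" b] artin_eq_context[of b b' a' "[]"]
  unfolding artin_eq_def by (auto intro: equivclp_trans)

text \<open>The product of \<open>artin_group\<close> picks representatives by choice; this leads
  back from the chosen word to the given one.\<close>

lemma some_cls: "artin_eq V E m w (SOME a. a \<in> cls w)"
proof -
  have "w \<in> cls w" by (simp add: artin_class_def artin_eq_def)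
  then have "(SOME a. a \<in> cls w) \<in> cls w" by (rule someI)
  then show ?thesis by (simp add: artin_class_def)
qed

lemma cls_mult [simp]: "cls a \<otimes>\<^bsub>AG\<^esub> cls b = cls (a @ b)"
proof -
  have "artin_eq V E m (a @ b) ((SOME x. x \<in> cls a) @ (SOME x. x \<in> cls b))"
    by (intro artin_eq_append some_cls)
  then show ?thesis by (simp add: artin_group_def cls_eq_iff artin_eq_def equivclp_sym)
qed

lemma cls_one: "\<one>\<^bsub>AG\<^esub> = cls []" by (simp add: artin_group_def)

lemma carrier_AG: "carrier AG = cls ` words V" by (simp add: artin_group_def)

lemma words_Nil [simp]: "[] \<in> words S"
  and words_Cons [simp]: "p # w \<in> words S \<longleftrightarrow> fst p \<in> S \<and> w \<in> words S"
  and words_append [simp]: "w @ w' \<in> words S \<longleftrightarrow> w \<in> words S \<and> w' \<in> words S"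
  by (auto simp: words_def)

lemma cls_cancel: "x \<in> V \<Longrightarrow> cls [(x, b), (x, \<not> b)] = cls []"
  unfolding cls_eq_iff artin_eq_def
  using artin_step.cancel[of x V E m "[]" b "[]"] by auto

lemma inverse_word:
  assumes "w \<in> words V"
  shows "\<exists>w'\<in>words V. cls (w' @ w) = cls []"
  using assms
proof (induction w)
  case (Cons p w)
  obtain x b where p: "p = (x, b)" by force
  from Cons obtain w' where w': "w' \<in> words V" "cls (w' @ w) = cls []" by auto
  have "cls ((w' @ [(x, \<not> b)]) @ p # w) = cls (w' @ [(x, \<not> b), (x, \<not> \<not> b)] @ w)"
    by (simp add: p)
  also have "\<dots> = cls w' \<otimes>\<^bsub>AG\<^esub> (cls [(x, \<not> b), (x, \<not> \<not> b)] \<otimes>\<^bsub>AG\<^esub> cls w)"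
    by simp
  also have "\<dots> = cls []"
    using Cons.prems w' by (subst cls_cancel) (auto simp: p)
  finally show ?case using w' Cons.prems p by (intro bexI[of _ "w' @ [(x, \<not> b)]"]) auto
qed auto

sublocale AG: group AG
proof (rule groupI)
  fix x y assume "x \<in> carrier AG" "y \<in> carrier AG"
  then show "x \<otimes>\<^bsub>AG\<^esub> y \<in> carrier AG" by (force simp: carrier_AG)
next
  show "\<one>\<^bsub>AG\<^esub> \<in> carrier AG" by (auto simp: carrier_AG cls_one)
next
  fix x y z assume "x \<in> carrier AG" "y \<in> carrier AG" "z \<in> carrier AG"
  then show "x \<otimes>\<^bsub>AG\<^esub> y \<otimes>\<^bsub>AG\<^esub> z = x \<otimes>\<^bsub>AG\<^esub> (y \<otimes>\<^bsub>AG\<^esub> z)"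
    by (auto simp: carrier_AG)
next
  fix x assume "x \<in> carrier AG"
  then show "\<one>\<^bsub>AG\<^esub> \<otimes>\<^bsub>AG\<^esub> x = x"
    by (auto simp: carrier_AG cls_one)
next
  fix x assume "x \<in> carrier AG"
  then show "\<exists>y\<in>carrier AG. y \<otimes>\<^bsub>AG\<^esub> x = \<one>\<^bsub>AG\<^esub>"
    using inverse_word by (force simp: carrier_AG cls_one)
qed

lemma gen_closed: "x \<in> V \<Longrightarrow> gen x \<in> carrier AG"
  by (auto simp: gen_def carrier_AG)

lemma gen_inv: "x \<in> V \<Longrightarrow> inv\<^bsub>AG\<^esub> gen x = cls [(x, False)]"
  using cls_cancel[of x False]
  by (intro AG.inv_equality) (auto simp: gen_def cls_one carrier_AG)

text \<open>Agrees with \<open>std_parabolic\<close> for \<open>S \<subseteq> V\<close>, but as a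
  generated subgroup it lets homomorphisms be compared and bounded on generators.\<close>

definition par :: "'v set \<Rightarrow> 'v word set set" where "par S = generate AG (gen ` S)"

lemma gens_closed: "S \<subseteq> V \<Longrightarrow> gen ` S \<subseteq> carrier AG"
  using gen_closed by auto

lemma par_subgroup: "S \<subseteq> V \<Longrightarrow> subgroup (par S) AG"
  unfolding par_def by (intro AG.generate_is_subgroup gens_closed)

lemma par_closed: "S \<subseteq> V \<Longrightarrow> g \<in> par S \<Longrightarrow> g \<in> carrier AG"
  by (rule subgroup.mem_carrier[OF par_subgroup])

lemma par_mono: "S \<subseteq> T \<Longrightarrow> par S \<subseteq> par T"
  unfolding par_def by (intro AG.mono_generate) auto

lemma gen_in_par: "x \<in> S \<Longrightarrow> gen x \<in> par S"
  unfolding par_def by (intro generate.incl) auto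

lemma std_parabolic_eq_par:
  assumes "S \<subseteq> V"
  shows "std_parabolic V E m S = par S"
proof
  show "std_parabolic V E m S \<subseteq> par S"
  proof
    fix g assume "g \<in> std_parabolic V E m S"
    then obtain w where "w \<in> words S" "g = cls w" by (auto simp: std_parabolic_def)
    moreover have "cls w \<in> par S" if "w \<in> words S" for w
      using that
    proof (induction w)
      case Nil
      then show ?case using subgroup.one_closed[OF par_subgroup[OF assms]] by (simp add: cls_one)
    next
      case (Cons p w)
      obtain x b where p: "p = (x, b)" by force
      have "cls [p] \<in> par S"
        using subgroup.m_inv_closed[OF par_subgroup[OF assms], of "gen x"] gen_inv[of x]
          gen_in_par[of x S] Cons.prems assms p by (cases b) (auto simp: gen_def)
      then have "cls [p] \<otimes>\<^bsub>AG\<^esub> cls w \<in> par S"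
        using Cons subgroup.m_closed[OF par_subgroup[OF assms]] by (auto simp del: cls_mult)
      then show ?case by simp
    qed
    ultimately show "g \<in> par S" by simp
  qed
next
  have "g \<in> std_parabolic V E m S" if "g \<in> generate AG (gen ` S)" for g
    using that
  proof induction
    case one
    show ?case by (auto simp: std_parabolic_def cls_one)
  next
    case (incl h)
    then show ?case by (force simp: std_parabolic_def gen_def)
  next
    case (inv h)
    then show ?case using assms gen_inv by (force simp: std_parabolic_def)
  next
    case (eng h1 h2)
    then obtain w1 w2 where "w1 \<in> words S" "w2 \<in> words S" "h1 = cls w1" "h2 = cls w2"
      by (auto simp: std_parabolic_def)
    then show ?case by (simp add: std_parabolic_def)
  qed
  then show "par S \<subseteq> std_parabolic V E m S" by (auto simp: par_def)
qed

lemma carrier_eq_par: "carrier AG = par V"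
  using std_parabolic_eq_par[of V] by (simp add: std_parabolic_def carrier_AG)

end

section \<open>Even labels: universal property, retractions, exponent sums\<close>

locale even_artin = artin +
  assumes evens: "\<forall>e\<in>E. even (m e)"
begin

text \<open>For an even label 2k both sides of the braid relation are k-th powers. In this form the
  relation makes sense in any group and no longer mentions words.\<close>

lemma gen_relation:
  assumes "{u, v} \<in> E"
  shows "(gen u \<otimes>\<^bsub>AG\<^esub> gen v) [^]\<^bsub>AG\<^esub> (m {u, v} div 2) = (gen v \<otimes>\<^bsub>AG\<^esub> gen u) [^]\<^bsub>AG\<^esub> (m {u, v} div 2)"
proof -
  have *: "cls (prodw x y (2 * k)) = (gen x \<otimes>\<^bsub>AG\<^esub> gen y) [^]\<^bsub>AG\<^esub> k" for x y k
  proof (induction k)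
    case (Suc k)
    have "prodw x y (2 * Suc k) = prodw x y (2 * k) @ [(x, True), (y, True)]"
      by (simp add: prodw_def)
    then have "cls (prodw x y (2 * Suc k)) = cls (prodw x y (2 * k)) \<otimes>\<^bsub>AG\<^esub> cls [(x, True), (y, True)]"
      by (simp only: cls_mult)
    also have "cls [(x, True), (y, True)] = gen x \<otimes>\<^bsub>AG\<^esub> gen y"
      by (simp add: gen_def)
    finally show ?case using Suc by simp
  qed (simp add: prodw_def cls_one)
  have "cls (prodw u v (m {u, v})) = cls (prodw v u (m {u, v}))"
    unfolding cls_eq_iff artin_eq_def
    using artin_step.braid[OF assms, where a = "[]" and c = "[]"] by auto
  moreover obtain k where k: "m {u, v} = 2 * k" using evens assms by auto
  ultimately show ?thesis by (simp add: *)
qed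

lemma universal:
  assumes "group Q" and f: "\<And>x. x \<in> V \<Longrightarrow> f x \<in> carrier Q"
    and rel: "\<And>u v. {u, v} \<in> E \<Longrightarrow>
      (f u \<otimes>\<^bsub>Q\<^esub> f v) [^]\<^bsub>Q\<^esub> (m {u, v} div 2) = (f v \<otimes>\<^bsub>Q\<^esub> f u) [^]\<^bsub>Q\<^esub> (m {u, v} div 2)"
  shows "\<exists>\<phi>\<in>hom AG Q. \<forall>x\<in>V. \<phi> (gen x) = f x"
proof -
  interpret Q: group Q by fact
  \<comment> \<open>The contexts in \<open>artin_step\<close> may contain letters outside
    \<open>V\<close>; sending these to the identity makes evaluation multiplicative on all
    words.\<close>
  define f' where "f' x = (if x \<in> V then f x else \<one>\<^bsub>Q\<^esub>)" for x
  have f': "f' x \<in> carrier Q" for x using f by (auto simp: f'_def)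
  note ap = Q.word_eval_append[OF f'] and cl = Q.word_eval_closed[of _ f', OF f']
  have st: "Q.word_eval f' w = Q.word_eval f' w'" if "artin_step V E m w w'" for w w'
    using that
  proof (induction rule: artin_step.induct)
    case (cancel x a b c)
    have "Q.word_eval f' [(x, b), (x, \<not> b)] = \<one>\<^bsub>Q\<^esub>"
      using f'[of x] by simp
    then show ?case by (simp only: ap Q.l_one cl)
  next
    case (braid u v a c)
    obtain k where k: "m {u, v} = 2 * k" using evens braid by auto
    have "Q.word_eval f' (prodw u v (m {u, v})) = Q.word_eval f' (prodw v u (m {u, v}))"
      using rel[OF braid] edge_in[OF braid] unfolding k
      by (simp add: Q.word_eval_prodw[OF f']) (simp add: f'_def)
    then show ?case by (simp add: ap)
  qed
  have eq: "Q.word_eval f' w = Q.word_eval f' w'" if "artin_eq V E m w w'" for w w'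
    using that unfolding artin_eq_def
  proof (induction rule: equivclp_induct)
    case (step y z) then show ?case using st[of y z] st[of z y] by auto
  qed simp
  define \<phi> where "\<phi> A = Q.word_eval f' (SOME a. a \<in> A)" for A
  have \<phi>: "\<phi> (cls w) = Q.word_eval f' w" for w
    unfolding \<phi>_def by (rule eq[symmetric], rule some_cls)
  have "\<phi> \<in> hom AG Q"
    by (rule homI) (auto simp: carrier_AG \<phi> cl ap)
  moreover have "\<forall>x\<in>V. \<phi> (gen x) = f x"
    using f by (simp add: gen_def \<phi> f'_def)
  ultimately show ?thesis by blast
qed

text \<open>Killing generators respects an even relation: once one of u, v becomes the identity,
  (uv)^k and (vu)^k coincide. An odd label would force the other generator to die as well.\<close>

lemma retraction:
  assumes "S \<subseteq> V"
  shows "\<exists>\<rho>\<in>hom AG AG. (\<forall>x\<in>S. \<rho> (gen x) = gen x) \<and> (\<forall>x\<in>V - S. \<rho> (gen x) = \<one>\<^bsub>AG\<^esub>)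
     \<and> (\<forall>g\<in>par S. \<rho> g = g)"
proof -
  let ?f = "\<lambda>x. if x \<in> S then gen x else \<one>\<^bsub>AG\<^esub>"
  have "\<exists>\<rho>\<in>hom AG AG. \<forall>x\<in>V. \<rho> (gen x) = ?f x"
    using gen_closed gen_relation edge_in by (intro universal) (auto simp: AG.is_group)
  then obtain \<rho> where \<rho>: "\<rho> \<in> hom AG AG" "\<forall>x\<in>V. \<rho> (gen x) = ?f x" by blast
  have "\<rho> g = g" if "g \<in> par S" for g
    using hom_eq_on_generate[of AG AG \<rho> id "gen ` S" g] \<rho> assms that gens_closed[OF assms]
    by (fastforce simp: par_def id_def intro: homI)
  with \<rho> assms show ?thesis by (intro bexI[of _ \<rho>]) auto
qed

text \<open>Exponent sum in the single generator \<open>v\<close>, well defined because both sides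
  of an even relation contain each generator equally often.\<close>

lemma degree:
  assumes "v \<in> V"
  shows "\<exists>\<delta>\<in>hom AG integer_group. \<delta> (gen v) = 1 \<and> (\<forall>x\<in>V - {v}. \<delta> (gen x) = 0)"
proof -
  have "\<exists>\<delta>\<in>hom AG integer_group. \<forall>x\<in>V. \<delta> (gen x) = (if x = v then 1 else 0)"
  proof (rule universal)
    fix a b
    let ?f = "\<lambda>x. if x = v then 1 else 0 :: int"
    have "?f a \<otimes>\<^bsub>integer_group\<^esub> ?f b = ?f b \<otimes>\<^bsub>integer_group\<^esub> ?f a"
      by simp
    then show "(?f a \<otimes>\<^bsub>integer_group\<^esub> ?f b) [^]\<^bsub>integer_group\<^esub> (m {a, b} div 2)
      = (?f b \<otimes>\<^bsub>integer_group\<^esub> ?f a) [^]\<^bsub>integer_group\<^esub> (m {a, b} div 2)"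
      by (rule arg_cong)
  qed simp_all
  then obtain \<delta> where \<delta>: "\<delta> \<in> hom AG integer_group" "\<forall>x\<in>V. \<delta> (gen x) = (if x = v then 1 else 0)"
    by blast
  show ?thesis by (rule bexI[OF _ \<delta>(1)]) (use \<delta>(2) assms in auto)
qed

text \<open>The retraction onto \<open>par S\<close> fixes a common element, yet it maps
  \<open>par T\<close> into \<open>par (S \<inter> T)\<close>, since it sends each generator in
  \<open>T\<close> either to itself or to the identity.\<close>

lemma par_Int:
  assumes "S \<subseteq> V" "T \<subseteq> V"
  shows "par S \<inter> par T = par (S \<inter> T)"
proof
  obtain \<rho> where \<rho>: "\<rho> \<in> hom AG AG" "\<forall>x\<in>S. \<rho> (gen x) = gen x"
    "\<forall>x\<in>V - S. \<rho> (gen x) = \<one>\<^bsub>AG\<^esub>" "\<forall>g\<in>par S. \<rho> g = g"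
    using retraction[OF assms(1)] by blast
  have sub: "subgroup (par (S \<inter> T)) AG" by (rule par_subgroup) (use assms in auto)
  show "par S \<inter> par T \<subseteq> par (S \<inter> T)"
  proof
    fix g assume g: "g \<in> par S \<inter> par T"
    have "\<rho> (gen x) \<in> par (S \<inter> T)" if "x \<in> T" for x
    proof (cases "x \<in> S")
      case True
      then show ?thesis using \<rho>(2) gen_in_par[of x "S \<inter> T"] that by simp
    next
      case False
      then have "\<rho> (gen x) = \<one>\<^bsub>AG\<^esub>" using \<rho>(3) that assms by blast
      then show ?thesis using subgroup.one_closed[OF sub] by simp
    qed
    then have "\<rho> g \<in> par (S \<inter> T)"
      using generate_subset_closed[OF AG.is_group AG.is_group \<rho>(1) gens_closed[OF assms(2)] sub, of g] g
      by (auto simp: par_def[of T])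
    then show "g \<in> par (S \<inter> T)" using \<rho>(4) g by (metis IntD1)
  qed
  show "par (S \<inter> T) \<subseteq> par S \<inter> par T" using par_mono[of "S \<inter> T" S] par_mono[of "S \<inter> T" T] by auto
qed

end

section \<open>Root-closed subgroups of amalgams\<close>

text \<open>Relative to \<open>K\<close>, so that all subgroups stay inside one ambient group and
  chains of root-closed inclusions compose.\<close>

definition root_closed :: "('a, 'b) monoid_scheme \<Rightarrow> 'a set \<Rightarrow> 'a set \<Rightarrow> bool" where
  "root_closed G H K \<longleftrightarrow> (\<forall>g\<in>K. \<forall>n>0. g [^]\<^bsub>G\<^esub> (n::nat) \<in> H \<longrightarrow> g \<in> H)"

lemma root_closedD: "root_closed G H K \<Longrightarrow> g \<in> K \<Longrightarrow> 0 < n \<Longrightarrow> g [^]\<^bsub>G\<^esub> (n::nat) \<in> H \<Longrightarrow> g \<in> H"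
  by (auto simp: root_closed_def)

lemma root_closed_trans:
  "root_closed G H K \<Longrightarrow> root_closed G K L \<Longrightarrow> H \<subseteq> K \<Longrightarrow> root_closed G H L"
  unfolding root_closed_def by blast

section \<open>Permutation groups, alternating words and products\<close>

definition perm_group :: "('a \<Rightarrow> 'a) monoid" where
  "perm_group = \<lparr>carrier = {f. bij f}, mult = (\<circ>), one = id\<rparr>"

lemma perm_group_simps [simp]:
  "carrier perm_group = {f. bij f}" "f \<otimes>\<^bsub>perm_group\<^esub> g = f \<circ> g" "\<one>\<^bsub>perm_group\<^esub> = id"
  by (simp_all add: perm_group_def)

lemma group_perm_group: "group perm_group"
proof (rule groupI)
  fix f :: "'a \<Rightarrow> 'a" assume "f \<in> carrier perm_group"
  then show "\<exists>g\<in>carrier perm_group. g \<otimes>\<^bsub>perm_group\<^esub> f = \<one>\<^bsub>perm_group\<^esub>"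
    by (intro bexI[of _ "inv_into UNIV f"]) (auto simp: bij_is_inj bij_imp_bij_inv)
qed (auto simp: bij_comp comp_assoc)

fun alternating :: "'a set \<Rightarrow> 'a set \<Rightarrow> 'a list \<Rightarrow> bool" where
  "alternating X Y [] \<longleftrightarrow> True"
| "alternating X Y (x # xs) \<longleftrightarrow> x \<in> X \<and> x \<notin> Y \<and> alternating Y X xs"

lemma alternating_append:
  "alternating X Y (xs @ ys) \<longleftrightarrow>
    alternating X Y xs \<and> (if even (length xs) then alternating X Y ys else alternating Y X ys)"
  by (induction X Y xs rule: alternating.induct) auto

lemma even_length_concat_replicate: "even (length xs) \<Longrightarrow> even (length (concat (replicate n xs)))"
  by (induction n) auto

lemma alternating_concat_replicate:
  "alternating X Y xs \<Longrightarrow> even (length xs) \<Longrightarrow> alternating X Y (concat (replicate n xs))"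
  by (induction n) (auto simp: alternating_append)

primrec (in monoid) lprod :: "'a list \<Rightarrow> 'a" where
  "lprod [] = \<one>"
| "lprod (x # xs) = x \<otimes> lprod xs"

context group
begin

lemma lprod_closed: "set xs \<subseteq> carrier G \<Longrightarrow> lprod xs \<in> carrier G"
  by (induction xs) auto

lemma lprod_append:
  "set xs \<subseteq> carrier G \<Longrightarrow> set ys \<subseteq> carrier G \<Longrightarrow> lprod (xs @ ys) = lprod xs \<otimes> lprod ys"
  by (induction xs) (auto simp: lprod_closed m_assoc)

lemma lprod_concat_replicate:
  "set xs \<subseteq> carrier G \<Longrightarrow> lprod (concat (replicate n xs)) = lprod xs [^] n"
proof (induction n)
  case (Suc n)
  have "set (concat (replicate n xs)) \<subseteq> carrier G" using Suc.prems by auto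
  then show ?case using Suc nat_pow_Suc2[of "lprod xs" n] by (simp add: lprod_append lprod_closed)
qed simp

lemma lprod_hom:
  assumes "group H" "h \<in> hom G H" "set xs \<subseteq> carrier G"
  shows "h (lprod xs) = monoid.lprod H (map h xs)"
proof -
  interpret h: group_hom G H h using assms by (simp add: group_hom_def group_hom_axioms_def)
  show ?thesis using assms(3) by (induction xs) (auto simp: lprod_closed)
qed

lemma lprod_in_subgroup: "subgroup H G \<Longrightarrow> set xs \<subseteq> H \<Longrightarrow> lprod xs \<in> H"
  by (induction xs) (auto simp: subgroup.one_closed subgroup.m_closed)

text \<open>Peels generators off the left, which is the side on which the normal forms below are
  updated. The induction behind it shows that left multiplication by any generated element preserves
  \<open>P\<close>.\<close>

lemma generate_left_induct:
  assumes S: "S \<subseteq> carrier G" and g: "g \<in> generate G S" and one: "P \<one>"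
    and incl: "\<And>s x. s \<in> S \<Longrightarrow> x \<in> generate G S \<Longrightarrow> P x \<Longrightarrow> P (s \<otimes> x)"
    and inv: "\<And>s x. s \<in> S \<Longrightarrow> x \<in> generate G S \<Longrightarrow> P x \<Longrightarrow> P (inv s \<otimes> x)"
  shows "P g"
proof -
  have "\<forall>x\<in>generate G S. P x \<longrightarrow> P (h \<otimes> x)" if "h \<in> generate G S" for h
    using that
  proof induction
    case one
    then show ?case using generate_in_carrier[OF S] by simp
  next
    case (eng h1 h2)
    then show ?case
      using generate_in_carrier[OF S] by (auto simp: m_assoc intro: generate.eng)
  qed (use incl inv in auto)
  from this[OF g] have "P (g \<otimes> \<one>)" using one generate.one by blast
  then show ?thesis using generate_in_carrier[OF S g] by simp
qed

lemma generate_commute: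
  assumes S: "S \<subseteq> carrier G" and g: "g \<in> generate G S" and z: "z \<in> carrier G"
    and comm: "\<And>s. s \<in> S \<Longrightarrow> z \<otimes> s = s \<otimes> z"
  shows "z \<otimes> g = g \<otimes> z"
  using g
proof induction
  case (inv h)
  then have h: "h \<in> carrier G" "z \<otimes> h = h \<otimes> z" using S comm by auto
  have "z \<otimes> inv h = inv h \<otimes> (h \<otimes> z) \<otimes> inv h" using h(1) z by (simp flip: m_assoc)
  also have "\<dots> = inv h \<otimes> z" using h z by (simp flip: h(2) add: m_assoc)
  finally show ?case .
next
  case (eng h1 h2)
  then have h: "h1 \<in> carrier G" "h2 \<in> carrier G" using generate_in_carrier[OF S] by auto
  have "z \<otimes> (h1 \<otimes> h2) = (z \<otimes> h1) \<otimes> h2" using h z by (simp add: m_assoc)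
  also have "\<dots> = h1 \<otimes> (z \<otimes> h2)" using h z eng.IH(1) by (simp add: m_assoc)
  also have "\<dots> = h1 \<otimes> h2 \<otimes> z" using h z eng.IH(2) by (simp add: m_assoc)
  finally show ?case .
qed (use z comm in auto)

lemma conj_cancel:
  assumes "x \<in> carrier G" "y \<in> carrier G"
  shows "x \<otimes> (inv x \<otimes> y \<otimes> x) \<otimes> inv x = y" and "inv x \<otimes> (x \<otimes> y \<otimes> inv x) \<otimes> x = y"
proof -
  have "x \<otimes> (inv x \<otimes> y \<otimes> x) \<otimes> inv x = (x \<otimes> inv x) \<otimes> y \<otimes> (x \<otimes> inv x)"
    "inv x \<otimes> (x \<otimes> y \<otimes> inv x) \<otimes> x = (inv x \<otimes> x) \<otimes> y \<otimes> (inv x \<otimes> x)"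
    using assms by (simp_all only: m_assoc m_closed inv_closed)
  then show "x \<otimes> (inv x \<otimes> y \<otimes> x) \<otimes> inv x = y" "inv x \<otimes> (x \<otimes> y \<otimes> inv x) \<otimes> x = y"
    using assms by simp_all
qed

text \<open>Update rule for normal forms a x^i in a semidirect product: a letter x or its inverse on
  the left is moved past a, at the price of replacing a by its conjugate.\<close>

lemma intertwine_int_pow:
  assumes x: "x \<in> carrier G" and a: "a \<in> carrier G" and b: "b \<in> carrier G" and eq: "x \<otimes> a = b \<otimes> x"
  shows "x \<otimes> (a \<otimes> x [^] (i::int)) = b \<otimes> x [^] (1 + i)"
    and "inv x \<otimes> (b \<otimes> x [^] (i::int)) = a \<otimes> x [^] (- 1 + i)"
proof -
  have "x \<otimes> (a \<otimes> x [^] i) = b \<otimes> (x \<otimes> x [^] i)"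
    using x a b by (simp add: eq flip: m_assoc)
  then show "x \<otimes> (a \<otimes> x [^] i) = b \<otimes> x [^] (1 + i)"
    using int_pow_mult[OF x, of 1 i] x by simp
  have "inv x \<otimes> (b \<otimes> x) \<otimes> inv x = inv x \<otimes> b"
    using x b by (simp add: m_assoc)
  then have "inv x \<otimes> b = inv x \<otimes> (x \<otimes> a) \<otimes> inv x" by (simp add: eq)
  also have "\<dots> = a \<otimes> inv x" using x a by (simp flip: m_assoc)
  finally have "inv x \<otimes> (b \<otimes> x [^] i) = a \<otimes> (inv x \<otimes> x [^] i)"
    using x a b by (simp flip: m_assoc)
  then show "inv x \<otimes> (b \<otimes> x [^] i) = a \<otimes> x [^] (- 1 + i)"
    using int_pow_mult[OF x, of "- 1" i] x by (simp add: int_pow_neg)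
qed

definition conj_pow :: "'a \<Rightarrow> 'a \<Rightarrow> nat \<Rightarrow> 'a" where
  "conj_pow x y j = x [^] j \<otimes> y \<otimes> inv (x [^] j)"

lemma conj_pow_closed [simp]:
  "x \<in> carrier G \<Longrightarrow> y \<in> carrier G \<Longrightarrow> conj_pow x y j \<in> carrier G"
  by (simp add: conj_pow_def)

lemma conj_pow_0: "y \<in> carrier G \<Longrightarrow> conj_pow x y 0 = y"
  by (simp add: conj_pow_def)

lemma conj_pow_Suc:
  assumes "x \<in> carrier G" "y \<in> carrier G"
  shows "conj_pow x y (Suc j) = x \<otimes> conj_pow x y j \<otimes> inv x"
proof -
  have "conj_pow x y (Suc j) = (x \<otimes> x [^] j) \<otimes> y \<otimes> inv (x \<otimes> x [^] j)"
    using assms unfolding conj_pow_def by (simp only: nat_pow_Suc2)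
  then show ?thesis using assms by (simp add: conj_pow_def inv_mult_group m_assoc)
qed

text \<open>Collecting all x on the right gives (yx)^k = c_0 ... c_{k-1} x^k and (xy)^k = c_1 ...
  c_k x^k, where c_j is \<open>conj_pow x y j\<close>. After cancelling x^k the common middle c_1
  ... c_{k-1} is \<open>p\<close>. Used in both directions: to read off c_k in the Artin group, and
  to verify the relation for permutations.\<close>

lemma braid_relation_iff:
  assumes x: "x \<in> carrier G" and y: "y \<in> carrier G" and k: "0 < k"
  defines "p \<equiv> lprod (map (conj_pow x y) [1..<k])"
  shows "(x \<otimes> y) [^] k = (y \<otimes> x) [^] k \<longleftrightarrow> p \<otimes> conj_pow x y k = y \<otimes> p"
proof -
  let ?c = "conj_pow x y"
  have c: "?c j \<in> carrier G" for j using x y by simp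
  have cs: "set (map ?c js) \<subseteq> carrier G" for js using c by auto
  note cl = lprod_closed[OF cs]
  have cx: "?c j \<otimes> x [^] j = x [^] j \<otimes> y" for j using x y by (simp add: conj_pow_def m_assoc)
  have snoc: "lprod (map ?c (js @ [j])) = lprod (map ?c js) \<otimes> ?c j" for js j
    using c cs by (simp add: lprod_append)
  have "lprod (map ?c [0..<k]) \<otimes> x [^] k = (y \<otimes> x) [^] k" for k
  proof (induction k)
    case (Suc k)
    have "lprod (map ?c ([0..<k] @ [k])) \<otimes> x [^] Suc k = lprod (map ?c [0..<k]) \<otimes> (?c k \<otimes> x [^] k) \<otimes> x"
      unfolding snoc using cl c x by (simp add: m_assoc)
    also have "\<dots> = lprod (map ?c [0..<k]) \<otimes> x [^] k \<otimes> (y \<otimes> x)"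
      unfolding cx using cl x y by (simp add: m_assoc)
    finally show ?case using Suc by simp
  qed simp
  moreover have "lprod (map ?c [1..<Suc k]) \<otimes> x [^] k = (x \<otimes> y) [^] k" for k
  proof (induction k)
    case (Suc k)
    have "lprod (map ?c ([1..<Suc k] @ [Suc k])) \<otimes> x [^] Suc k = lprod (map ?c [1..<Suc k]) \<otimes> (?c (Suc k) \<otimes> x [^] Suc k)"
      unfolding snoc using cl c x by (simp add: m_assoc)
    also have "\<dots> = lprod (map ?c [1..<Suc k]) \<otimes> x [^] k \<otimes> (x \<otimes> y)"
      unfolding cx using cl x y by (simp add: m_assoc)
    finally show ?case using Suc by simp
  qed simp
  moreover have "[0..<k] = 0 # [1..<k]" "[1..<Suc k] = [1..<k] @ [k]"
    using k by (simp_all add: upt_conv_Cons)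
  ultimately have "(y \<otimes> p) \<otimes> x [^] k = (y \<otimes> x) [^] k" "(p \<otimes> ?c k) \<otimes> x [^] k = (x \<otimes> y) [^] k"
    unfolding p_def by (metis list.simps(9) lprod.simps(2) conj_pow_0[OF y], metis snoc)
  then have "(x \<otimes> y) [^] k = (y \<otimes> x) [^] k \<longleftrightarrow> (p \<otimes> ?c k) \<otimes> x [^] k = (y \<otimes> p) \<otimes> x [^] k"
    by simp
  also have "\<dots> \<longleftrightarrow> p \<otimes> ?c k = y \<otimes> p"
    using cl c x y by (intro right_cancel) (simp_all add: p_def)
  finally show ?thesis .
qed

end

section \<open>Action of two subgroups on normal forms\<close>

locale amalgam = group G for G (structure) +
  fixes A B :: "'a set"
  assumes sub_A: "subgroup A G" and sub_B: "subgroup B G"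
begin


abbreviation "C \<equiv> A \<inter> B"

text \<open>Leaves open which factor is called \<open>X\<close>, so that words starting in either
  factor are handled by one argument.\<close>

definition sides :: "'a set \<Rightarrow> 'a set \<Rightarrow> bool" where
  "sides X Y \<longleftrightarrow> (X = A \<and> Y = B) \<or> (X = B \<and> Y = A)"

lemma sides_sym: "sides X Y \<Longrightarrow> sides Y X" by (auto simp: sides_def)
lemma sides_Int: "sides X Y \<Longrightarrow> X \<inter> Y = C" by (auto simp: sides_def)
lemma sides_sub: "sides X Y \<Longrightarrow> subgroup X G" using sub_A sub_B by (auto simp: sides_def)

lemma sub_C: "subgroup C G"
  by (rule subgroups_Inter_pair[OF sub_A sub_B])

lemma sides_closed: "sides X Y \<Longrightarrow> x \<in> X \<Longrightarrow> x \<in> carrier G"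
  using sides_sub subgroup.mem_carrier by metis

lemma C_closed: "c \<in> C \<Longrightarrow> c \<in> carrier G"
  using sub_C subgroup.mem_carrier by metis

lemma side_mult_iff:
  assumes "sides X Y" "x \<in> X" "y \<in> carrier G"
  shows "x \<otimes> y \<in> X \<longleftrightarrow> y \<in> X" "y \<otimes> x \<in> X \<longleftrightarrow> y \<in> X"
proof -
  note s = sides_sub[OF assms(1)] and x = sides_closed[OF assms(1,2)]
  have "inv x \<otimes> (x \<otimes> y) = y" using x assms by (simp flip: m_assoc)
  moreover have "(y \<otimes> x) \<otimes> inv x = y" using x assms by (simp add: m_assoc)
  ultimately show "x \<otimes> y \<in> X \<longleftrightarrow> y \<in> X" "y \<otimes> x \<in> X \<longleftrightarrow> y \<in> X"
    using s assms(2) by (metis subgroup.m_closed subgroup.m_inv_closed)+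
qed

lemma C_sides: "sides X Y \<Longrightarrow> c \<in> C \<Longrightarrow> c \<in> X \<and> c \<in> Y"
  by (auto simp: sides_def)

lemma alternating_carrier:
  "alternating X Y xs \<Longrightarrow> sides X Y \<Longrightarrow> set xs \<subseteq> carrier G"
  by (induction X Y xs rule: alternating.induct) (auto dest: sides_closed sides_sym)

text \<open>\<open>rep\<close> chooses representatives of the right cosets of \<open>C\<close>, with \<open>\<one>\<close> representing \<open>C\<close> itself, so it
  serves both factors at once. The group will act on the normal forms \<open>c t\<^sub>1 t\<^sub>2 \<dots>\<close> in \<open>NF\<close>; \<open>dec X\<close>
  identifies \<open>NF\<close> with pairs of an element of \<open>X\<close> and a normal form not starting in \<open>X\<close>, on which \<open>X\<close>
  acts by left multiplication.\<close>

definition rep :: "'a \<Rightarrow> 'a" where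
  "rep x = (if x \<in> C then \<one> else SOME y. y \<in> C #> x)"

lemma rep_in: assumes "x \<in> carrier G" shows "rep x \<in> C #> x"
proof (cases "x \<in> C")
  case True
  then have "inv x \<in> C" by (rule subgroup.m_inv_closed[OF sub_C])
  moreover have "\<one> = inv x \<otimes> x" using assms by simp
  ultimately show ?thesis using True unfolding rep_def r_coset_def by auto
next
  case False
  have "x \<in> C #> x" by (rule rcos_self[OF assms sub_C])
  then have "(SOME y. y \<in> C #> x) \<in> C #> x" by (rule someI)
  then show ?thesis using False by (simp only: rep_def if_False)
qed

lemma rep_obtain:
  assumes "x \<in> carrier G"
  obtains c where "c \<in> C" "x = c \<otimes> rep x" "rep x \<in> carrier G"
proof -
  obtain c where c: "c \<in> C" "rep x = c \<otimes> x"
    using rep_in[OF assms] by (auto simp: r_coset_def)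
  then have "x = inv c \<otimes> rep x" using assms C_closed by (simp add: inv_solve_left m_assoc)
  moreover have "inv c \<in> C" using c sub_C by (meson subgroup.m_inv_closed)
  ultimately show ?thesis using that[of "inv c"] c assms C_closed by simp
qed

lemma C_mult_iff: "c \<in> C \<Longrightarrow> x \<in> carrier G \<Longrightarrow> c \<otimes> x \<in> C \<longleftrightarrow> x \<in> C"
  using side_mult_iff(1)[of A B c x] side_mult_iff(1)[of B A c x] by (auto simp: sides_def)

lemma rep_mult: assumes "c \<in> C" "x \<in> carrier G" shows "rep (c \<otimes> x) = rep x"
proof -
  have "C #> (c \<otimes> x) = C #> x"
    using assms coset_mult_assoc[of C c x] coset_join2[of c C] sub_C C_closed
      subgroup.subset[OF sub_C] by metis
  then show ?thesis using C_mult_iff[OF assms] by (simp only: rep_def)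
qed

lemma rep_C [simp]: "c \<in> C \<Longrightarrow> rep c = \<one>" by (simp add: rep_def)

lemma rep_side: assumes "sides X Y" "x \<in> X" shows "rep x \<in> X"
proof -
  obtain c where "c \<in> C" "x = c \<otimes> rep x" "rep x \<in> carrier G"
    using rep_obtain assms sides_closed by metis
  then show ?thesis using side_mult_iff(1)[OF assms(1), of c "rep x"] C_sides assms by metis
qed

lemma rep_notin: assumes "x \<in> carrier G" "x \<notin> C" shows "rep x \<notin> C" "rep (rep x) = rep x"
proof -
  obtain c where c: "c \<in> C" "x = c \<otimes> rep x" "rep x \<in> carrier G"
    using rep_obtain assms by metis
  show "rep x \<notin> C" using c C_mult_iff assms by metis
  show "rep (rep x) = rep x" using rep_mult[OF c(1,3)] c by simp
qed

definition nf :: "'a set \<Rightarrow> 'a set \<Rightarrow> 'a list \<Rightarrow> bool" where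
  "nf X Y ts \<longleftrightarrow> alternating X Y ts \<and> (\<forall>t\<in>set ts. rep t = t)"

definition NF :: "('a \<times> 'a list) set" where
  "NF = {(c, ts). c \<in> C \<and> (nf A B ts \<or> nf B A ts)}"

text \<open>Splits x as (element of \<open>C\<close>) times \<open>rep x\<close> and drops the
  representative when it is \<open>\<one>\<close>. No factor is mentioned: the same map inverts both
  \<open>dec A\<close> and \<open>dec B\<close>.\<close>

definition enc :: "'a \<times> 'a list \<Rightarrow> 'a \<times> 'a list" where
  "enc = (\<lambda>(x, ts). (x \<otimes> inv rep x, if x \<in> C then ts else rep x # ts))"

definition dec :: "'a set \<Rightarrow> 'a \<times> 'a list \<Rightarrow> 'a \<times> 'a list" where
  "dec X = (\<lambda>(c, ts). if ts \<noteq> [] \<and> hd ts \<in> X then (c \<otimes> hd ts, tl ts) else (c, ts))"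

lemma NF_sides: "sides X Y \<Longrightarrow> NF = {(c, ts). c \<in> C \<and> (nf X Y ts \<or> nf Y X ts)}"
  by (auto simp: NF_def sides_def)

lemma nf_Cons: "nf X Y (t # ts) \<longleftrightarrow> t \<in> X \<and> t \<notin> Y \<and> rep t = t \<and> nf Y X ts"
  by (auto simp: nf_def)

lemma nf_Nil [simp]: "nf X Y []" by (simp add: nf_def)

lemma enc_dec:
  assumes "sides X Y" "w \<in> NF"
  shows "enc (dec X w) = w" and "fst (dec X w) \<in> X" and "nf Y X (snd (dec X w))"
proof -
  obtain c ts where w: "w = (c, ts)" "c \<in> C" "nf X Y ts \<or> nf Y X ts"
    using assms by (auto simp: NF_sides)
  have c: "c \<in> carrier G" "c \<in> X" using w C_closed C_sides assms by auto
  have "enc (dec X w) = w \<and> fst (dec X w) \<in> X \<and> nf Y X (snd (dec X w))"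
  proof (cases "ts \<noteq> [] \<and> hd ts \<in> X")
    case True
    then obtain t r where ts: "ts = t # r" "t \<in> X" by (cases ts) auto
    then have t: "t \<notin> Y" "rep t = t" "nf Y X r" "t \<in> carrier G"
      using w assms by (auto simp: nf_Cons sides_closed)
    have "c \<otimes> t \<in> X" using side_mult_iff assms c ts t by blast
    moreover have "c \<otimes> t \<notin> C" using C_mult_iff[OF w(2) t(4)] t sides_Int[OF assms(1)] by blast
    moreover have "rep (c \<otimes> t) = t" using rep_mult[OF w(2) t(4)] t by simp
    ultimately show ?thesis using t ts w c by (simp add: enc_def dec_def m_assoc)
  next
    case False
    then have "nf Y X ts" using w by (cases ts) (auto simp: nf_Cons)
    then show ?thesis using False w c by (auto simp: enc_def dec_def)
  qed
  then show "enc (dec X w) = w" "fst (dec X w) \<in> X" "nf Y X (snd (dec X w))" by auto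
qed

lemma dec_enc:
  assumes "sides X Y" "x \<in> X" "nf Y X ts"
  shows "dec X (enc (x, ts)) = (x, ts)" and "enc (x, ts) \<in> NF"
proof -
  have x: "x \<in> carrier G" using assms sides_closed by blast
  obtain c where c: "c \<in> C" "x = c \<otimes> rep x" "rep x \<in> carrier G"
    using rep_obtain[OF x] .
  have xc: "x \<otimes> inv rep x = c"
    using c C_closed by (metis inv_solve_right' x)
  have "dec X (enc (x, ts)) = (x, ts) \<and> enc (x, ts) \<in> NF"
  proof (cases "x \<in> C")
    case True
    then have "hd ts \<notin> X" if "ts \<noteq> []" using that assms by (cases ts) (auto simp: nf_Cons)
    then show ?thesis using True x assms by (auto simp: enc_def dec_def NF_sides)
  next
    case False
    have "rep x \<in> X" by (rule rep_side) fact+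
    moreover have "rep x \<notin> Y" using rep_notin[OF x False] sides_Int assms calculation by blast
    ultimately show ?thesis using False c xc rep_notin[OF x False] assms
      by (auto simp: enc_def dec_def NF_sides[OF assms(1)] nf_Cons)
  qed
  then show "dec X (enc (x, ts)) = (x, ts)" "enc (x, ts) \<in> NF" by auto
qed

definition act :: "'a set \<Rightarrow> 'a \<Rightarrow> 'a \<times> 'a list \<Rightarrow> 'a \<times> 'a list" where
  "act X a w = (if w \<in> NF then enc (a \<otimes> fst (dec X w), snd (dec X w)) else w)"

lemma act_NF: assumes "sides X Y" "a \<in> X" "w \<in> NF" shows "act X a w \<in> NF"
  using enc_dec[OF assms(1,3)] assms side_mult_iff(1)[OF assms(1,2)] sides_closed[OF assms(1)]
  by (auto simp: act_def intro!: dec_enc)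

lemma act_mult:
  assumes "sides X Y" "a \<in> X" "b \<in> X"
  shows "act X (a \<otimes> b) = act X a \<circ> act X b"
proof
  fix w
  show "act X (a \<otimes> b) w = (act X a \<circ> act X b) w"
  proof (cases "w \<in> NF")
    case True
    note d = enc_dec[OF assms(1) True]
    have cl: "a \<in> carrier G" "b \<in> carrier G" "fst (dec X w) \<in> carrier G"
      using assms d sides_closed by auto
    then have "b \<otimes> fst (dec X w) \<in> X" using side_mult_iff assms d by blast
    then have "dec X (act X b w) = (b \<otimes> fst (dec X w), snd (dec X w))"
      using dec_enc(1)[OF assms(1) _ d(3)] True by (simp add: act_def)
    then show ?thesis using act_NF[OF assms(1,3) True] True cl
      by (simp add: act_def[of X a] act_def[of X "a \<otimes> b"] m_assoc)
  qed (simp add: act_def)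
qed

lemma act_one: assumes "sides X Y" shows "act X \<one> = id"
  using enc_dec[OF assms] sides_closed[OF assms] by (auto simp: act_def fun_eq_iff)

lemma act_hom:
  assumes "sides X Y"
  shows "act X \<in> hom (G\<lparr>carrier := X\<rparr>) perm_group"
proof (rule homI)
  fix a assume "a \<in> carrier (G\<lparr>carrier := X\<rparr>)"
  then have a: "a \<in> X" "inv a \<in> X" "a \<in> carrier G"
    using sides_sub[OF assms] sides_closed[OF assms] by (auto simp: subgroup.m_inv_closed)
  have "act X a \<circ> act X (inv a) = id" "act X (inv a) \<circ> act X a = id"
    using act_mult[OF assms a(1,2)] act_mult[OF assms a(2,1)] act_one[OF assms] a by auto
  then show "act X a \<in> carrier perm_group" by (simp add: o_bij)
qed (simp add: act_mult[OF assms])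

text \<open>Multiplication by \<open>C\<close> only changes the first component, because coset
  representatives ignore it. As \<open>X\<close> is absent from the result, the two factor actions
  agree on \<open>C\<close> and can be extended jointly.\<close>

lemma act_C:
  assumes "sides X Y" "c \<in> C" "(d, ts) \<in> NF"
  shows "act X c (d, ts) = (c \<otimes> d, ts)"
proof -
  have d: "d \<in> C" "nf X Y ts \<or> nf Y X ts" using assms by (auto simp: NF_sides)
  then have cl: "c \<in> carrier G" "d \<in> carrier G" "c \<otimes> d \<in> C"
    using assms C_closed C_mult_iff by auto
  then have cd: "(c \<otimes> d, ts) \<in> NF" using assms by (auto simp: NF_def)
  have "(c \<otimes> fst (dec X (d, ts)), snd (dec X (d, ts))) = dec X (c \<otimes> d, ts)"
  proof (cases "ts \<noteq> [] \<and> hd ts \<in> X")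
    case True
    then have "hd ts \<in> carrier G" using sides_closed assms by auto
    then show ?thesis using True cl by (simp add: dec_def m_assoc)
  qed (auto simp: dec_def)
  then show ?thesis using enc_dec(1)[OF assms(1) cd] assms by (simp add: act_def)
qed

lemma act_agree: assumes "c \<in> C" shows "act A c = act B c"
proof
  fix w show "act A c w = act B c w"
    using act_C[of A B c] act_C[of B A c] assms by (cases w; cases "w \<in> NF") (auto simp: sides_def act_def)
qed

end

text \<open>The existence half of the universal property of an amalgamated product, for the one
  target on which the normal form argument relies. Uniqueness is not demanded, so \<open>G\<close>
  may be larger than the group generated by \<open>A\<close> and \<open>B\<close>.\<close>

locale amalgam_universal = amalgam G A B for G (structure) and A B +
  assumes extension:
    "\<And>\<alpha> \<beta> :: 'a \<Rightarrow> 'a \<times> 'a list \<Rightarrow> 'a \<times> 'a list.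
      \<alpha> \<in> hom (G\<lparr>carrier := A\<rparr>) perm_group \<Longrightarrow> \<beta> \<in> hom (G\<lparr>carrier := B\<rparr>) perm_group \<Longrightarrow>
      (\<forall>c\<in>A \<inter> B. \<alpha> c = \<beta> c) \<Longrightarrow>
      \<exists>\<phi>\<in>hom G perm_group. (\<forall>a\<in>A. \<phi> a = \<alpha> a) \<and> (\<forall>b\<in>B. \<phi> b = \<beta> b)"
begin

text \<open>Applied to the empty normal form, an alternating product produces a normal form with as
  many letters as it has factors, whereas an element of \<open>A\<close> or \<open>B\<close>
  produces at most one letter.\<close>

lemma alternating_lprod_notin:
  assumes XY: "sides X Y" "alternating X Y xs" "2 \<le> length xs" and "sides X' Y'"
  shows "lprod xs \<notin> X'"
proof -
  obtain \<phi> where \<phi>: "\<phi> \<in> hom G perm_group" "\<forall>a\<in>A. \<phi> a = act A a" "\<forall>b\<in>B. \<phi> b = act B b"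
    using extension[OF act_hom act_hom, of B A] act_agree by (auto simp: sides_def)
  interpret \<phi>: group_hom G perm_group \<phi>
    using \<phi>(1) by (simp add: group_hom_def group_hom_axioms_def group_perm_group)
  have \<phi>s: "\<phi> x = act X x" if "sides X Y" "x \<in> X" for x X Y
    using that \<phi> by (auto simp: sides_def)
  have base: "(\<one>, []) \<in> NF" using subgroup.one_closed[OF sub_C] by (simp add: NF_def)
  have main: "\<phi> (lprod xs) (\<one>, []) \<in> NF \<and> nf X Y (snd (\<phi> (lprod xs) (\<one>, []))) \<and>
      length (snd (\<phi> (lprod xs) (\<one>, []))) = length xs" if "sides X Y" "alternating X Y xs" for X Y xs
    using that(2,1)
  proof (induction X Y xs rule: alternating.induct)
    case (1 X Y)
    then show ?case using base by simp
  next
    case (2 X Y x xs)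
    let ?w = "\<phi> (lprod xs) (\<one>, [])"
    have s: "sides Y X" using 2 sides_sym by blast
    have x: "x \<in> X" "x \<notin> Y" "x \<in> carrier G" using 2 sides_closed by auto
    have IH: "?w \<in> NF" "nf Y X (snd ?w)" "length (snd ?w) = length xs"
      using 2 s by auto
    have "set xs \<subseteq> carrier G" using 2 s alternating_carrier by auto
    then have eq: "\<phi> (lprod (x # xs)) (\<one>, []) = act X x ?w"
      using x lprod_closed \<phi>s 2 by simp
    \<comment> \<open>The normal form reached so far is empty or starts with a letter outside
      \<open>X\<close>, so nothing merges and \<open>x\<close> contributes a new letter.\<close>
    have "dec X ?w = ?w" using IH by (cases ?w; cases "snd ?w") (auto simp: dec_def nf_Cons)
    moreover have c: "fst ?w \<in> C" using IH by (auto simp: NF_def)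
    ultimately have act: "act X x ?w = enc (x \<otimes> fst ?w, snd ?w)"
      using IH by (simp add: act_def)
    have xc: "x \<otimes> fst ?w \<in> X" "x \<otimes> fst ?w \<notin> Y"
      using side_mult_iff[OF 2(3), of x "fst ?w"] side_mult_iff(2)[OF s, of "fst ?w" x] x c
        C_sides[OF s c] C_closed[OF c] by auto
    have cl: "x \<otimes> fst ?w \<in> carrier G" using x C_closed[OF c] by simp
    have nC: "x \<otimes> fst ?w \<notin> C" using xc C_sides[OF s] by blast
    have "rep (x \<otimes> fst ?w) \<in> X" by (rule rep_side[OF 2(3) xc(1)])
    moreover have "rep (x \<otimes> fst ?w) \<notin> Y"
      using rep_notin(1)[OF cl nC] calculation sides_Int[OF 2(3)] by blast
    ultimately show ?case
      using act_NF[OF 2(3) x(1) IH(1)] IH rep_notin(2)[OF cl nC] nC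
      unfolding eq by (simp add: act enc_def nf_Cons)
  qed
  show ?thesis
  proof
    assume g: "lprod xs \<in> X'"
    have "\<phi> (lprod xs) (\<one>, []) = enc (lprod xs \<otimes> \<one>, [])"
      using \<phi>s[OF assms(4) g] base by (simp add: act_def dec_def)
    then have "length (snd (\<phi> (lprod xs) (\<one>, []))) \<le> 1" by (simp add: enc_def)
    with main[OF assms(1,2)] assms(3) show False by simp
  qed
qed

text \<open>A conjugate \<open>x z x\<inverse>\<close> of an alternating product of odd length is shortened until it is cyclically
  reduced up to one letter; root-closedness enters when a single letter is left.\<close>

lemma odd_power:
  assumes rc: "root_closed G C A" "root_closed G C B" and "0 < (n::nat)"
    and "sides X Y" "alternating X Y xs" "odd (length xs)"
  shows "\<exists>ys. alternating X Y ys \<and> odd (length ys) \<and> length xs \<le> length ys \<and> lprod ys = lprod xs [^] n"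
  using assms(4-)
proof (induction "length xs" arbitrary: xs X Y rule: less_induct)
  case less
  note s = \<open>sides X Y\<close>
  have s': "sides Y X" using s sides_sym by blast
  obtain x us where xs: "xs = x # us" using less.prems by (cases xs) auto
  have x: "x \<in> X" "x \<notin> Y" "x \<in> carrier G" "alternating Y X us" "even (length us)"
    using less.prems xs sides_closed[OF s] by auto
  show ?case
  proof (cases "us = []")
    case True
    have "x [^] n \<in> X"
      using subgroup_int_pow_closed[OF sides_sub[OF s] x(1), of "int n"] by (simp add: int_pow_int)
    moreover have "x [^] n \<notin> Y"
    proof
      assume "x [^] n \<in> Y"
      then have "x [^] n \<in> C" using calculation sides_Int[OF s] by blast
      moreover have "root_closed G C X" using rc s by (auto simp: sides_def)
      ultimately have "x \<in> C" using x(1) \<open>0 < n\<close> root_closedD by metis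
      then show False using x C_sides[OF s] by blast
    qed
    ultimately show ?thesis using x True xs by (intro exI[of _ "[x [^] n]"]) auto
  next
    case False
    then obtain zs y where us: "us = zs @ [y]" by (metis rev_exhaust)
    have zs: "alternating Y X zs" "odd (length zs)" and y: "y \<in> X" "y \<notin> Y" "y \<in> carrier G"
      using x us sides_closed[OF s] by (auto simp: alternating_append)
    have zc: "set zs \<subseteq> carrier G" using alternating_carrier[OF zs(1) s'] .
    \<comment> \<open>The letter that arises at the seam between two consecutive copies of
      \<open>xs\<close>.\<close>
    define d where "d = y \<otimes> x"
    have d: "d \<in> X" "d \<in> carrier G" using x y side_mult_iff[OF s] by (auto simp: d_def)
    define Z where "Z = lprod zs"
    have Z: "Z \<in> carrier G" using zc lprod_closed by (simp add: Z_def)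
    have lp: "lprod xs = x \<otimes> (Z \<otimes> y)"
      using x y zc xs us by (simp add: lprod_append Z_def)
    show ?thesis
    proof (cases "d \<in> Y")
      case False
      obtain k where k: "n = Suc k" using \<open>0 < n\<close> gr0_conv_Suc by auto
      \<comment> \<open>Merging at the n - 1 = k seams is the only reduction: \<open>d\<close> lies
        in \<open>X\<close> but not in \<open>Y\<close>, so the result alternates.\<close>
      let ?ys = "x # zs @ concat (replicate k (d # zs)) @ [y]"
      have "alternating X Y (d # zs)" "even (length (d # zs))" using d zs False by auto
      from alternating_concat_replicate[OF this, of k] even_length_concat_replicate[OF this(2), of k]
      have "alternating X Y ?ys" "odd (length ?ys)"
        using x y zs by (auto simp: alternating_append)
      moreover have "length xs \<le> length ?ys" using xs us by simp
      moreover have "lprod ?ys = lprod xs [^] n"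
      proof -
        have "set (concat (replicate k (d # zs))) \<subseteq> carrier G" using zc d by auto
        then have "lprod ?ys = x \<otimes> (Z \<otimes> ((d \<otimes> Z) [^] k \<otimes> y))"
          using lprod_concat_replicate[of "d # zs" k] zc d x y
          by (simp add: lprod_append Z_def)
        also have "\<dots> = (x \<otimes> (Z \<otimes> y)) [^] Suc k"
        proof (induction k)
          case 0 then show ?case using x y Z by simp
        next
          case (Suc k)
          have "x \<otimes> (Z \<otimes> ((d \<otimes> Z) [^] Suc k \<otimes> y)) = x \<otimes> (Z \<otimes> ((d \<otimes> Z) [^] k \<otimes> y)) \<otimes> (x \<otimes> (Z \<otimes> y))"
            using x y Z d by (simp add: m_assoc d_def)
          with Suc show ?case by simp
        qed
        finally show ?thesis using lp k by simp
      qed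
      ultimately show ?thesis by blast
    next
      case True
      then have dC: "d \<in> C" using d sides_Int[OF s] by blast
      obtain vs z where zs': "zs = vs @ [z]" using zs(2) by (metis even_zero list.size(3) rev_exhaust)
      have z: "z \<in> Y" "z \<notin> X" "z \<in> carrier G" "alternating Y X vs" "even (length vs)"
        using zs zs' sides_closed[OF s'] by (auto simp: alternating_append)
      \<comment> \<open>Since y = d x^-1, the product of \<open>xs\<close> is the conjugate by
        \<open>x\<close> of Z d. As \<open>d\<close> lies in \<open>C\<close>, it is absorbed by the
        last letter of \<open>zs\<close>; the new word is two letters shorter and starts in the
        other factor.\<close>
      let ?zs = "vs @ [z \<otimes> d]"
      have "z \<otimes> d \<in> Y" "z \<otimes> d \<notin> X"
        using side_mult_iff(2)[OF s', of d z] side_mult_iff(2)[OF s, of d z] z d True by auto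
      then have a: "alternating Y X ?zs" "odd (length ?zs)"
        using z by (auto simp: alternating_append)
      moreover have "length ?zs < length xs" using xs us zs' by simp
      ultimately obtain ys where ys: "alternating Y X ys" "odd (length ys)"
        "length ?zs \<le> length ys" "lprod ys = lprod ?zs [^] n"
        using less.hyps s' by blast
      have vc: "set vs \<subseteq> carrier G" using zc zs' by simp
      have zsd: "lprod ?zs = Z \<otimes> d"
        using vc z d lprod_closed[OF vc] by (simp add: lprod_append Z_def zs' m_assoc)
      have "y = d \<otimes> inv x" using x y by (simp add: d_def m_assoc)
      then have "lprod xs = x \<otimes> lprod ?zs \<otimes> inv x"
        using lp x Z d zsd by (simp add: m_assoc)
      then have "lprod xs [^] n = x \<otimes> lprod ys \<otimes> inv x"
        using pow_conj[of x "lprod ?zs" n] x Z d zsd ys by simp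
      moreover have yc: "set ys \<subseteq> carrier G" using alternating_carrier[OF ys(1) s'] .
      \<comment> \<open>Conjugating back puts \<open>x\<close> and its inverse around
        \<open>ys\<close>, which starts and ends in \<open>Y\<close> outside \<open>X\<close>, so no
        letters merge and the two lost letters are regained.\<close>
      then have "lprod (x # ys @ [inv x]) = x \<otimes> lprod ys \<otimes> inv x"
        using x lprod_closed[OF yc] by (simp add: lprod_append m_assoc)
      moreover have ix: "inv x \<in> X" "inv x \<notin> Y"
        using x sides_sub[OF s] sides_sub[OF s'] by (auto simp: subgroup.m_inv_closed)
          (metis inv_inv subgroup.m_inv_closed)
      then have "alternating X Y (x # ys @ [inv x])"
        using x ys by (simp add: alternating_append)
      moreover have "length xs \<le> length (x # ys @ [inv x])" using ys xs us zs' by simp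
      ultimately show ?thesis using ys by (intro exI[of _ "x # ys @ [inv x]"]) auto
    qed
  qed
qed

text \<open>Left multiplication by a factor element affects at most the first two letters: it is
  prefixed or merged with the first letter, and a merged letter that falls into \<open>C\<close> is
  absorbed by the second.\<close>

lemma alternating_exists:
  assumes "g \<in> generate G (A \<union> B)"
  shows "g \<in> C \<or> (\<exists>X Y xs. sides X Y \<and> xs \<noteq> [] \<and> alternating X Y xs \<and> g = lprod xs)"
proof -
  define N where "N = C \<union> {lprod xs | X Y xs. sides X Y \<and> xs \<noteq> [] \<and> alternating X Y xs}"
  have NI: "lprod xs \<in> N" if "sides X Y" "xs \<noteq> []" "alternating X Y xs" for X Y xs
    using that by (auto simp: N_def)
  have NC: "N \<subseteq> carrier G"
  proof
    fix g assume "g \<in> N"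
    then consider "g \<in> C" | X Y xs where "sides X Y" "alternating X Y xs" "g = lprod xs"
      unfolding N_def by blast
    then show "g \<in> carrier G"
      using C_closed alternating_carrier lprod_closed by cases auto
  qed
  have mult: "a \<otimes> g \<in> N" if s: "sides X Y" and a: "a \<in> X" and g: "g \<in> N" for a g X Y
  proof -
    have s': "sides Y X" using s sides_sym by blast
    have ac: "a \<in> carrier G" using a s sides_closed by blast
    have side: "x \<in> N" if "x \<in> X" for x
      using NI[OF s, of "[x]"] that sides_closed[OF s] sides_Int[OF s] by (auto simp: N_def)
    consider "g \<in> C" | x xs where "alternating X Y (x # xs)" "g = lprod (x # xs)"
      | x xs where "alternating Y X (x # xs)" "g = lprod (x # xs)"
      using g s unfolding N_def sides_def by (auto simp: neq_Nil_conv)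
    then show ?thesis
    proof cases
      case 1
      then have "g \<in> X" "g \<in> carrier G" using C_sides[OF s] C_closed by auto
      then show ?thesis using side side_mult_iff(1)[OF s a] by blast
    next
      case (2 x xs)
      have x: "x \<in> X" "x \<notin> Y" "x \<in> carrier G" "alternating Y X xs"
        using 2 sides_closed[OF s] by auto
      then have xsc: "set xs \<subseteq> carrier G" using alternating_carrier s' by blast
      have ax: "a \<otimes> x \<in> X" "a \<otimes> x \<in> carrier G" using side_mult_iff[OF s a] x ac by auto
      have ag: "a \<otimes> g = a \<otimes> x \<otimes> lprod xs" using x xsc 2 ac lprod_closed by (simp add: m_assoc)
      show ?thesis
      proof (cases "a \<otimes> x \<in> Y \<and> xs \<noteq> []")
        case False
        then show ?thesis
        proof (cases "xs = []")
          case True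
          then show ?thesis using ag ax side by simp
        next
          case nonempty: False
          then have "alternating X Y ((a \<otimes> x) # xs)" using False ax x by auto
          from NI[OF s _ this] show ?thesis using ag by simp
        qed
      next
        case True
        then obtain y ys where xs: "xs = y # ys" by (cases xs) auto
        have y: "y \<in> Y" "y \<notin> X" "y \<in> carrier G" "alternating X Y ys" "set ys \<subseteq> carrier G"
          using x xsc xs sides_closed[OF s'] by auto
        have "a \<otimes> x \<otimes> y \<in> Y" "a \<otimes> x \<otimes> y \<notin> X"
          using side_mult_iff(1)[OF s' _ y(3), of "a \<otimes> x"] side_mult_iff(1)[OF s ax(1) y(3)] True y by auto
        then have "alternating Y X ((a \<otimes> x \<otimes> y) # ys)" using y by auto
        from NI[OF s' _ this] show ?thesis using ag xs ax y lprod_closed by (simp add: m_assoc)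
      qed
    next
      case (3 x xs)
      have x: "x \<in> Y" "x \<notin> X" "x \<in> carrier G" "alternating X Y xs"
        using 3 sides_closed[OF s'] by auto
      then have xsc: "set xs \<subseteq> carrier G" using alternating_carrier s by blast
      show ?thesis
      proof (cases "a \<in> Y")
        case True
        have "a \<otimes> x \<in> Y" "a \<otimes> x \<notin> X"
          using side_mult_iff(1)[OF s' True] side_mult_iff(1)[OF s a] x by auto
        then have "alternating Y X ((a \<otimes> x) # xs)" using x by auto
        from NI[OF s' _ this] show ?thesis using 3 x xsc ac lprod_closed by (simp add: m_assoc)
      next
        case False
        then have "alternating X Y (a # x # xs)" using x a by auto
        from NI[OF s _ this] show ?thesis using 3 by simp
      qed
    qed
  qed
  have AB: "A \<union> B \<subseteq> carrier G" using sub_A sub_B subgroup.subset by blast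
  have inv_AB: "inv h \<in> A \<union> B" if "h \<in> A \<union> B" for h
    using that sub_A sub_B by (auto simp: subgroup.m_inv_closed)
  have "\<one> \<in> N" using subgroup.one_closed[OF sub_C] by (simp add: N_def)
  then have "g \<in> N"
    using mult[of A B] mult[of B A] inv_AB
    by (intro generate_left_induct[OF AB assms, of "\<lambda>x. x \<in> N"]) (auto simp: sides_def, blast+)
  then show ?thesis by (auto simp: N_def)
qed

text \<open>An alternating word of even length starts and ends in different factors, so its powers
  alternate without any reduction and are too long for \<open>A\<close>. For odd length,
  \<open>odd_power\<close> yields a word for the power that is at least as long and starts in the
  same factor; if the power lies in \<open>A\<close>, both words are single letters, and the letter
  of the power shows that this factor is \<open>A\<close>.\<close>

theorem amalgam_root_closed:
  assumes rc: "root_closed G C A" "root_closed G C B"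
  shows "root_closed G A (generate G (A \<union> B))"
  unfolding root_closed_def
proof (intro ballI allI impI)
  fix g and n :: nat
  assume g: "g \<in> generate G (A \<union> B)" and n: "0 < n" and gn: "g [^] n \<in> A"
  have sAB: "sides A B" by (simp add: sides_def)
  from alternating_exists[OF g] show "g \<in> A"
  proof (elim disjE exE conjE)
    fix X Y xs assume s: "sides X Y" and xs: "xs \<noteq> []" "alternating X Y xs" "g = lprod xs"
    note xc = alternating_carrier[OF xs(2) s]
    show ?thesis
    proof (cases "even (length xs)")
      case True
      have "alternating X Y (concat (replicate n xs))"
        by (rule alternating_concat_replicate) fact+
      moreover have "length xs \<le> length (concat (replicate n xs))" using n by (cases n) auto
      moreover have "2 \<le> length xs" using True xs(1) by (cases xs; cases "tl xs") auto
      ultimately have "lprod (concat (replicate n xs)) \<notin> A"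
        using alternating_lprod_notin[OF s _ _ sAB] by auto
      then show ?thesis using gn xs xc lprod_concat_replicate by simp
    next
      case False
      from odd_power[OF rc n s xs(2) this] obtain ys where ys: "alternating X Y ys"
        "odd (length ys)" "length xs \<le> length ys" "lprod ys = g [^] n" using xs by auto
      have "\<not> 2 \<le> length ys" using alternating_lprod_notin[OF s ys(1) _ sAB] ys gn by auto
      moreover have "0 < length xs" using xs(1) by simp
      ultimately have "length ys = 1" "length xs = 1" using ys(3) by linarith+
      then obtain x y where xy: "xs = [x]" "ys = [y]" by (auto simp: length_Suc_conv)
      then have "y \<in> X" "y \<notin> Y" "y \<in> A"
        using ys gn sides_closed[OF s] by auto
      then have "X = A" using s by (auto simp: sides_def)
      then show ?thesis using xy xs sides_closed[OF s] by auto
    qed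
  qed simp
qed

end

section \<open>Amalgams of even Artin groups\<close>

lemma root_closed_subset: "root_closed G H K \<Longrightarrow> K' \<subseteq> K \<Longrightarrow> root_closed G H K'"
  unfolding root_closed_def by blast

context even_artin
begin

lemma par_in_sub:
  assumes "S \<subseteq> V"
  shows "generate (AG\<lparr>carrier := par S\<rparr>) (gen ` S) = par S"
  using AG.generate_consistent[OF _ par_subgroup[OF assms], of "gen ` S"] gen_in_par
  unfolding par_def by (simp add: image_subset_iff generate.incl)

text \<open>The edge condition says that every relation among generators of
  \<open>V1 \<union> V2\<close> lives in one of the two parts, so two homomorphisms agreeing on the
  intersection fit together. The ambient group remains that of all of \<open>V\<close>.\<close>

lemma amalgam_par:
  assumes V12: "V1 \<subseteq> V" "V2 \<subseteq> V"
    and E12: "\<And>a b. {a, b} \<in> E \<Longrightarrow> a \<in> V1 \<union> V2 \<Longrightarrow> b \<in> V1 \<union> V2 \<Longrightarrow> {a, b} \<subseteq> V1 \<or> {a, b} \<subseteq> V2"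
    and rc: "root_closed AG (par (V1 \<inter> V2)) (par V1)" "root_closed AG (par (V1 \<inter> V2)) (par V2)"
  shows "root_closed AG (par V1) (par (V1 \<union> V2))"
proof -
  interpret amalgam_universal AG "par V1" "par V2"
  proof (intro amalgam_universal.intro amalgam.intro amalgam_axioms.intro amalgam_universal_axioms.intro)
    show "group AG" by (rule AG.is_group)
    show "subgroup (par V1) AG" "subgroup (par V2) AG" using V12 par_subgroup by auto
    fix \<alpha> \<beta> :: "'a word set \<Rightarrow> 'a word set \<times> 'a word set list \<Rightarrow> 'a word set \<times> 'a word set list"
    assume \<alpha>: "\<alpha> \<in> hom (AG\<lparr>carrier := par V1\<rparr>) perm_group"
      and \<beta>: "\<beta> \<in> hom (AG\<lparr>carrier := par V2\<rparr>) perm_group"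
      and agree: "\<forall>c\<in>par V1 \<inter> par V2. \<alpha> c = \<beta> c"
    \<comment> \<open>Generators outside both parts act as the identity, which satisfies every even
      relation.\<close>
    define f where "f x = (if x \<in> V1 then \<alpha> (gen x) else if x \<in> V2 then \<beta> (gen x) else id)" for x
    have f1: "f x = \<alpha> (gen x)" if "x \<in> V1" for x using that by (simp add: f_def)
    have f2: "f x = \<beta> (gen x)" if "x \<in> V2" for x
      using that agree gen_in_par by (auto simp: f_def)
    have rel: "(f a \<otimes>\<^bsub>perm_group\<^esub> f b) [^]\<^bsub>perm_group\<^esub> (m {a, b} div 2) =
        (f b \<otimes>\<^bsub>perm_group\<^esub> f a) [^]\<^bsub>perm_group\<^esub> (m {a, b} div 2)"
      if e: "{a, b} \<in> E" and ab: "{a, b} \<subseteq> W" and W: "W \<subseteq> V"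
        and h: "h \<in> hom (AG\<lparr>carrier := par W\<rparr>) perm_group" and fh: "\<And>x. x \<in> W \<Longrightarrow> f x = h (gen x)"
      for a b W h
    proof -
      let ?H = "AG\<lparr>carrier := par W\<rparr>"
      interpret H: group ?H by (rule AG.subgroup_imp_group[OF par_subgroup[OF W]])
      interpret h: group_hom ?H perm_group h
        using h by (simp add: group_hom_def group_hom_axioms_def group_perm_group H.is_group)
      have g: "gen a \<in> carrier ?H" "gen b \<in> carrier ?H" using ab gen_in_par by auto
      have pw: "h ((x \<otimes>\<^bsub>AG\<^esub> y) [^]\<^bsub>AG\<^esub> k) = (h x \<otimes>\<^bsub>perm_group\<^esub> h y) [^]\<^bsub>perm_group\<^esub> k"
        if "x \<in> carrier ?H" "y \<in> carrier ?H" for x y and k :: nat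
        using h.hom_nat_pow[of "x \<otimes>\<^bsub>?H\<^esub> y" k] h.hom_mult[OF that] H.m_closed[OF that]
        by (simp add: AG.nat_pow_consistent[symmetric] del: perm_group_simps)
      show ?thesis
        using pw[OF g, of "m {a, b} div 2"] pw[OF g(2,1), of "m {a, b} div 2"] gen_relation[OF e] fh ab
        by (simp del: perm_group_simps)
    qed
    have "\<exists>\<phi>\<in>hom AG perm_group. \<forall>x\<in>V. \<phi> (gen x) = f x"
    proof (rule universal[OF group_perm_group])
      fix x assume "x \<in> V"
      then show "f x \<in> carrier perm_group"
        using hom_in_carrier[OF \<alpha>, of "gen x"] hom_in_carrier[OF \<beta>, of "gen x"] gen_in_par
        by (auto simp: f_def)
    next
      fix a b assume e: "{a, b} \<in> E"
      show "(f a \<otimes>\<^bsub>perm_group\<^esub> f b) [^]\<^bsub>perm_group\<^esub> (m {a, b} div 2) =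
        (f b \<otimes>\<^bsub>perm_group\<^esub> f a) [^]\<^bsub>perm_group\<^esub> (m {a, b} div 2)"
      proof (cases "a \<in> V1 \<union> V2 \<and> b \<in> V1 \<union> V2")
        case True
        then show ?thesis using E12[OF e] rel[OF e _ V12(1) \<alpha> f1] rel[OF e _ V12(2) \<beta> f2] by blast
      next
        case False
        then have "f a = id \<or> f b = id" by (auto simp: f_def)
        then show ?thesis by auto
      qed
    qed
    then obtain \<phi> where \<phi>: "\<phi> \<in> hom AG perm_group" "\<forall>x\<in>V. \<phi> (gen x) = f x" by blast
    have ext: "\<phi> g = h g"
      if W: "W \<subseteq> V" and h: "h \<in> hom (AG\<lparr>carrier := par W\<rparr>) perm_group"
        and fh: "\<And>x. x \<in> W \<Longrightarrow> f x = h (gen x)" and g: "g \<in> par W" for W h g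
    proof (rule hom_eq_on_generate[of "AG\<lparr>carrier := par W\<rparr>" perm_group])
      show "group (AG\<lparr>carrier := par W\<rparr>)" by (rule AG.subgroup_imp_group[OF par_subgroup[OF W]])
      show "\<phi> \<in> hom (AG\<lparr>carrier := par W\<rparr>) perm_group"
        using \<phi>(1) par_closed[OF W] by (auto simp: hom_def)
      show "g \<in> generate (AG\<lparr>carrier := par W\<rparr>) (gen ` W)" using g par_in_sub[OF W] by simp
      show "gen ` W \<subseteq> carrier (AG\<lparr>carrier := par W\<rparr>)" using gen_in_par by auto
    qed (use h fh \<phi> W group_perm_group in auto)
    show "\<exists>\<phi>\<in>hom AG perm_group. (\<forall>a\<in>par V1. \<phi> a = \<alpha> a) \<and> (\<forall>b\<in>par V2. \<phi> b = \<beta> b)"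
      using \<phi>(1) ext[OF V12(1) \<alpha> f1] ext[OF V12(2) \<beta> f2] by blast
  qed
  have "root_closed AG (par V1) (generate AG (par V1 \<union> par V2))"
    using rc V12 by (intro amalgam_root_closed) (simp_all only: par_Int)
  moreover have "par (V1 \<union> V2) \<subseteq> generate AG (par V1 \<union> par V2)"
    unfolding par_def[of "V1 \<union> V2"] using gen_in_par by (intro AG.mono_generate) auto
  ultimately show ?thesis by (rule root_closed_subset)
qed

text \<open>As \<open>x\<close> commutes with \<open>par N\<close>, every element is c x^i with c in
  \<open>par N\<close>. The exponent sum in \<open>x\<close> is i, and for the n-th power it is n i,
  which must vanish.\<close>

lemma central_root_closed:
  assumes x: "x \<in> V" "x \<notin> N" and N: "N \<subseteq> V" and E: "\<And>t. t \<in> N \<Longrightarrow> {x, t} \<in> E \<and> m {x, t} = 2"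
  shows "root_closed AG (par N) (par (insert x N))"
  unfolding root_closed_def
proof (intro ballI allI impI)
  fix g and n :: nat
  assume g: "g \<in> par (insert x N)" and n: "0 < n" and gn: "g [^]\<^bsub>AG\<^esub> n \<in> par N"
  have xN: "insert x N \<subseteq> V" using x N by simp
  note gx = gen_closed[OF x(1)] and sN = par_subgroup[OF N]
  have comm: "c \<otimes>\<^bsub>AG\<^esub> gen x = gen x \<otimes>\<^bsub>AG\<^esub> c" if "c \<in> par N" for c
  proof -
    have "gen x \<otimes>\<^bsub>AG\<^esub> s = s \<otimes>\<^bsub>AG\<^esub> gen x" if "s \<in> gen ` N" for s
    proof -
      from that obtain t where t: "t \<in> N" "s = gen t" by auto
      then have "gen t \<in> carrier AG" using gen_closed N by auto
      then show ?thesis using gen_relation[of x t] E[OF t(1)] gx t(2) by simp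
    qed
    from AG.generate_commute[OF gens_closed[OF N] that[unfolded par_def] gx this]
    show ?thesis by simp
  qed
  have "\<exists>c\<in>par N. \<exists>i::int. g = c \<otimes>\<^bsub>AG\<^esub> gen x [^]\<^bsub>AG\<^esub> i"
  proof (rule AG.generate_left_induct[OF gens_closed[OF xN] g[unfolded par_def]])
    show "\<exists>c\<in>par N. \<exists>i::int. \<one>\<^bsub>AG\<^esub> = c \<otimes>\<^bsub>AG\<^esub> gen x [^]\<^bsub>AG\<^esub> i"
      using subgroup.one_closed[OF sN] by (intro bexI[of _ "\<one>\<^bsub>AG\<^esub>"] exI[of _ 0]) auto
  next
    have step: "\<exists>c\<in>par N. \<exists>i::int. s' \<otimes>\<^bsub>AG\<^esub> g = c \<otimes>\<^bsub>AG\<^esub> gen x [^]\<^bsub>AG\<^esub> i"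
      if "s' \<in> par N \<or> s' = gen x \<or> s' = inv\<^bsub>AG\<^esub> gen x"
        and "\<exists>c\<in>par N. \<exists>i::int. g = c \<otimes>\<^bsub>AG\<^esub> gen x [^]\<^bsub>AG\<^esub> i" for s' g
    proof -
      from that(2) obtain c and i :: int where c: "c \<in> par N" "g = c \<otimes>\<^bsub>AG\<^esub> gen x [^]\<^bsub>AG\<^esub> i" by blast
      have cc: "c \<in> carrier AG" using c par_closed[OF N] by blast
      from that(1) show ?thesis
      proof (elim disjE)
        assume s: "s' \<in> par N"
        then have "s' \<otimes>\<^bsub>AG\<^esub> g = (s' \<otimes>\<^bsub>AG\<^esub> c) \<otimes>\<^bsub>AG\<^esub> gen x [^]\<^bsub>AG\<^esub> i"
          using c cc par_closed[OF N] gx by (simp add: AG.m_assoc)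
        then show ?thesis using subgroup.m_closed[OF sN s c(1)] by blast
      next
        assume "s' = gen x"
        then have "s' \<otimes>\<^bsub>AG\<^esub> g = c \<otimes>\<^bsub>AG\<^esub> gen x [^]\<^bsub>AG\<^esub> (1 + i)"
          using AG.intertwine_int_pow(1)[OF gx cc cc comm[OF c(1), symmetric]] c(2) by simp
        then show ?thesis using c by blast
      next
        assume "s' = inv\<^bsub>AG\<^esub> gen x"
        then have "s' \<otimes>\<^bsub>AG\<^esub> g = c \<otimes>\<^bsub>AG\<^esub> gen x [^]\<^bsub>AG\<^esub> (- 1 + i)"
          using AG.intertwine_int_pow(2)[OF gx cc cc comm[OF c(1), symmetric]] c(2) by simp
        then show ?thesis using c by blast
      qed
    qed
    fix s g
    assume s: "s \<in> gen ` insert x N" and g: "\<exists>c\<in>par N. \<exists>i::int. g = c \<otimes>\<^bsub>AG\<^esub> gen x [^]\<^bsub>AG\<^esub> i"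
    have "s \<in> par N \<or> s = gen x" using s gen_in_par by auto
    then have "s \<in> par N \<and> inv\<^bsub>AG\<^esub> s \<in> par N \<or> s = gen x"
      using subgroup.m_inv_closed[OF sN] by blast
    then show "\<exists>c\<in>par N. \<exists>i::int. s \<otimes>\<^bsub>AG\<^esub> g = c \<otimes>\<^bsub>AG\<^esub> gen x [^]\<^bsub>AG\<^esub> i"
      "\<exists>c\<in>par N. \<exists>i::int. inv\<^bsub>AG\<^esub> s \<otimes>\<^bsub>AG\<^esub> g = c \<otimes>\<^bsub>AG\<^esub> gen x [^]\<^bsub>AG\<^esub> i"
      using step[of s g] step[of "inv\<^bsub>AG\<^esub> s" g] g by auto
  qed
  then obtain c and i :: int where c: "c \<in> par N" "g = c \<otimes>\<^bsub>AG\<^esub> gen x [^]\<^bsub>AG\<^esub> i" by blast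
  obtain \<delta> where \<delta>: "\<delta> \<in> hom AG integer_group" "\<delta> (gen x) = 1" "\<forall>y\<in>V - {x}. \<delta> (gen y) = 0"
    using degree[OF x(1)] by blast
  interpret \<delta>: group_hom AG integer_group \<delta>
    using \<delta>(1) by (simp add: group_hom_def group_hom_axioms_def AG.is_group)
  have cc: "c \<in> carrier AG" using c par_closed[OF N] by blast
  have \<delta>N: "\<delta> h = 0" if "h \<in> par N" for h
  proof -
    have "\<delta> h \<in> {\<one>\<^bsub>integer_group\<^esub>}"
      by (rule generate_subset_closed[OF AG.is_group group_integer_group \<delta>(1) gens_closed[OF N]
            group.triv_subgroup[OF group_integer_group] _ that[unfolded par_def]])
        (use x N \<delta>(3) in auto)
    then show ?thesis by simp
  qed
  have "0 = \<delta> (g [^]\<^bsub>AG\<^esub> n)" using \<delta>N[OF gn] by simp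
  also have "\<dots> = \<delta> g [^]\<^bsub>integer_group\<^esub> n"
    using c cc gx by (intro \<delta>.hom_nat_pow) auto
  also have "\<delta> g = i"
    using c cc gx \<delta>N[OF c(1)] \<delta>.hom_int_pow[OF gx, of i] \<delta>(2) by simp
  finally have "i = 0" using n by (simp flip: int_pow_int)
  then show "g \<in> par N" using c cc by simp
qed

end

section \<open>Cones in EAFC systems\<close>

text \<open>\<open>\<theta>\<close> inverts \<open>\<phi>\<close> on the generators
  \<open>T\<close>, hence on everything they generate: a root is carried to \<open>G\<close>,
  located there, and carried back. Outside these subgroups the two maps may be far from
  inverse.\<close>

lemma root_closed_transfer:
  assumes G: "group G" and H: "group H" and \<phi>: "\<phi> \<in> hom G H" and \<theta>: "\<theta> \<in> hom H G"
    and ST: "S \<subseteq> T" "T \<subseteq> carrier G"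
    and inv: "\<And>t. t \<in> T \<Longrightarrow> \<theta> (\<phi> t) = t"
    and rc: "root_closed G (generate G S) (generate G T)"
  shows "root_closed H (generate H (\<phi> ` S)) (generate H (\<phi> ` T))"
  unfolding root_closed_def
proof (intro ballI allI impI)
  interpret G: group G by fact
  interpret H: group H by fact
  interpret \<phi>: group_hom G H \<phi> using \<phi> by unfold_locales
  interpret \<theta>: group_hom H G \<theta> using \<theta> by unfold_locales
  fix g and n :: nat
  assume g: "g \<in> generate H (\<phi> ` T)" and n: "0 < n" and gn: "g [^]\<^bsub>H\<^esub> n \<in> generate H (\<phi> ` S)"
  have Sc: "S \<subseteq> carrier G" using ST by auto
  have image: "\<theta> h \<in> generate G U" if "h \<in> generate H (\<phi> ` U)" "U \<subseteq> T" for h U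
  proof -
    have U: "U \<subseteq> carrier G" using ST that by auto
    then have "\<phi> ` U \<subseteq> carrier H" by auto
    moreover have "\<theta> s \<in> generate G U" if "s \<in> \<phi> ` U" for s
      using that inv \<open>U \<subseteq> T\<close> generate.incl[of _ U G] by force
    ultimately show ?thesis
      by (rule generate_subset_closed[OF H G \<theta> _ G.generate_is_subgroup[OF U] _ that(1)])
  qed
  have gc: "g \<in> carrier H" using g ST by (intro H.generate_in_carrier[of "\<phi> ` T"]) auto
  have "\<theta> g [^]\<^bsub>G\<^esub> n \<in> generate G S"
    using image[OF gn ST(1)] gc by (simp add: \<theta>.hom_nat_pow)
  then have "\<theta> g \<in> generate G S" using root_closedD[OF rc image[OF g] n] by simp
  then have "\<phi> (\<theta> g) \<in> generate H (\<phi> ` S)"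
    by (rule generate_subset_closed[OF G H \<phi> Sc H.generate_is_subgroup, rotated 2])
      (use Sc in \<open>auto intro: generate.incl\<close>)
  moreover have "(\<phi> \<circ> \<theta>) g = id g"
  proof (rule hom_eq_on_generate[OF H H _ _ _ _ g])
    show "\<phi> \<circ> \<theta> \<in> hom H H" by (rule hom_compose[OF \<theta> \<phi>])
    show "id \<in> hom H H" by (auto simp: hom_def)
  qed (use ST inv in auto)
  ultimately show "g \<in> generate H (\<phi> ` S)" by simp
qed

text \<open>\<open>L\<close> is any finite set of neighbours of \<open>v\<close>; in the final
  induction it is the link inside the current vertex set, not inside \<open>V\<close>.\<close>

locale eafc_cone = even_artin +
  fixes v L
  assumes eafc: "\<And>a b c. {a, b} \<in> E \<Longrightarrow> {b, c} \<in> E \<Longrightarrow> {a, c} \<in> E \<Longrightarrow>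
        (m {a, b} = 2 \<and> m {b, c} = 2) \<or> (m {a, b} = 2 \<and> m {a, c} = 2) \<or> (m {b, c} = 2 \<and> m {a, c} = 2)"
    and L: "\<And>t. t \<in> L \<Longrightarrow> {v, t} \<in> E" and fin_L: "finite L" and v: "v \<in> V"
begin

text \<open>The copy \<open>(t, j)\<close> stands for the conjugate of \<open>t\<close> by \<open>v ^ j\<close>. Only \<open>kap t\<close> copies are needed:
  the relation between \<open>v\<close> and \<open>t\<close> expresses the next conjugate through these, which gives the
  last case of \<open>nxt\<close> below, and makes \<open>shift\<close> (conjugation by \<open>v\<close>) an automorphism.\<close>

definition kap :: "'a \<Rightarrow> nat" where "kap t = m {v, t} div 2"

definition dV :: "('a \<times> nat) set" where "dV = {(t, j). t \<in> L \<and> j < kap t}"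

text \<open>Copies are joined as their originals are. As \<open>{t, t}\<close> is never an edge, no
  defining relation links two copies of one vertex.\<close>

definition dE :: "('a \<times> nat) set set" where
  "dE = {{(t, i), (t', j)} | t t' i j. {t, t'} \<in> E \<and> (t, i) \<in> dV \<and> (t', j) \<in> dV}"

definition dm :: "('a \<times> nat) set \<Rightarrow> nat" where "dm e = m (fst ` e)"

lemma L_sub: "L \<subseteq> V" using L edge_in by blast
lemma v_notin: "v \<notin> L" using L edge_in by blast

lemma kap_pos: "t \<in> L \<Longrightarrow> 0 < kap t"
proof -
  assume "t \<in> L"
  then have "2 \<le> m {v, t}" using L[of t] sys by (simp add: artin_system_def)
  then show ?thesis by (simp add: kap_def)
qed

lemma m_kap: "t \<in> L \<Longrightarrow> m {v, t} = 2 * kap t"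
  using L[of t] evens by (simp add: kap_def)

text \<open>In the triangle v, t, t' the label of {v, t} exceeds 2, so the EAFC condition makes the
  other two labels 2. This is where that condition enters.\<close>

lemma kap_edge:
  assumes "{t, t'} \<in> E" "t \<in> L" "t' \<in> L" "1 < kap t"
  shows "kap t' = 1" "m {t, t'} = 2"
  using eafc[of v t t'] L[OF assms(2)] L[OF assms(3)] assms m_kap[of t] m_kap[of t'] by auto

lemma dE_iff: "{(t, i), (t', j)} \<in> dE \<longleftrightarrow> {t, t'} \<in> E \<and> (t, i) \<in> dV \<and> (t', j) \<in> dV"
  unfolding dE_def by (auto simp: doubleton_eq_iff insert_commute)

sublocale D: even_artin dV dE dm
proof unfold_locales
  show "artin_system dV dE dm"
    using sys edge_in unfolding artin_system_def dE_def dm_def by fastforce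
  show "\<forall>e\<in>dE. even (dm e)" using evens by (auto simp: dE_def dm_def)
qed

lemma dm_eq [simp]: "dm {(t, i), (t', j)} = m {t, t'}" by (simp add: dm_def)

text \<open>By \<open>kap_edge\<close>, an edge between copies either joins two vertices with one
  copy each, or has label 2 and an endpoint with a single copy. Only these two kinds of relation
  remain to be checked.\<close>

lemma dup_hom:
  assumes Q: "group Q" and f: "\<And>x. x \<in> dV \<Longrightarrow> f x \<in> carrier Q"
    and rel: "\<And>s t. {s, t} \<in> E \<Longrightarrow> s \<in> L \<Longrightarrow> t \<in> L \<Longrightarrow> kap s = 1 \<Longrightarrow> kap t = 1 \<Longrightarrow>
      (f (s, 0) \<otimes>\<^bsub>Q\<^esub> f (t, 0)) [^]\<^bsub>Q\<^esub> (m {s, t} div 2) = (f (t, 0) \<otimes>\<^bsub>Q\<^esub> f (s, 0)) [^]\<^bsub>Q\<^esub> (m {s, t} div 2)"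
    and comm: "\<And>s t i. {s, t} \<in> E \<Longrightarrow> (s, i) \<in> dV \<Longrightarrow> t \<in> L \<Longrightarrow> kap t = 1 \<Longrightarrow> m {s, t} = 2 \<Longrightarrow>
      f (s, i) \<otimes>\<^bsub>Q\<^esub> f (t, 0) = f (t, 0) \<otimes>\<^bsub>Q\<^esub> f (s, i)"
  shows "\<exists>\<phi>\<in>hom D.AG Q. \<forall>x\<in>dV. \<phi> (D.gen x) = f x"
proof (rule D.universal[OF Q f])
  fix x y assume e: "{x, y} \<in> dE"
  obtain s i t j where xy: "x = (s, i)" "y = (t, j)" by force
  have st: "{s, t} \<in> E" "s \<in> L" "t \<in> L" "(s, i) \<in> dV" "(t, j) \<in> dV" "i < kap s" "j < kap t"
    using e by (auto simp: xy dE_iff dV_def)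
  have ts: "{t, s} \<in> E" "m {t, s} = m {s, t}" using st by (simp_all add: insert_commute)
  consider "kap s = 1" "kap t = 1" | "1 < kap s" | "1 < kap t"
    using kap_pos st by (metis less_one linorder_neqE_nat not_less_zero)
  then show "(f x \<otimes>\<^bsub>Q\<^esub> f y) [^]\<^bsub>Q\<^esub> (dm {x, y} div 2) = (f y \<otimes>\<^bsub>Q\<^esub> f x) [^]\<^bsub>Q\<^esub> (dm {x, y} div 2)"
  proof cases
    case 1
    then show ?thesis using rel[of s t] st by (simp add: xy)
  next
    case 2
    then show ?thesis using kap_edge[OF st(1-3) 2] comm[of s t i] st by (simp add: xy)
  next
    case 3
    then show ?thesis using kap_edge[OF ts(1) st(3,2) 3] comm[of t s j] st ts by (simp add: xy)
  qed
qed

lemma dgen_comm: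
  assumes "{s, t} \<in> E" "(s, i) \<in> dV" "(t, j) \<in> dV" "m {s, t} = 2"
  shows "D.gen (s, i) \<otimes>\<^bsub>D.AG\<^esub> D.gen (t, j) = D.gen (t, j) \<otimes>\<^bsub>D.AG\<^esub> D.gen (s, i)"
  using D.gen_relation[of "(s, i)" "(t, j)"] assms D.gen_closed by (simp add: dE_iff)

section \<open>The shift automorphism of the group on the copies\<close>

definition blk :: "'a \<Rightarrow> ('a \<times> nat) set" where "blk t = {t} \<times> {..<kap t}"

lemma blk_sub: "t \<in> L \<Longrightarrow> blk t \<subseteq> dV" by (auto simp: blk_def dV_def)

text \<open>If s and t are joined with label 2 and t has a single copy, this copy commutes with all
  copies of s, hence with whatever \<open>f\<close> assigns to them inside their block.\<close>

lemma block_endo: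
  assumes f: "\<And>t i. (t, i) \<in> dV \<Longrightarrow> f (t, i) \<in> D.par (blk t)"
    and f1: "\<And>t. t \<in> L \<Longrightarrow> kap t = 1 \<Longrightarrow> f (t, 0) = D.gen (t, 0)"
  shows "\<exists>\<phi>\<in>hom D.AG D.AG. \<forall>x\<in>dV. \<phi> (D.gen x) = f x"
proof (rule dup_hom[OF D.AG.is_group])
  have fc: "f (t, i) \<in> carrier D.AG" if "(t, i) \<in> dV" for t i
    using f[OF that] that D.par_closed[OF blk_sub] by (auto simp: dV_def)
  then show "\<And>x. x \<in> dV \<Longrightarrow> f x \<in> carrier D.AG" by auto
  fix s t assume st: "{s, t} \<in> E" "t \<in> L" "kap t = 1"
  have t0: "(t, 0) \<in> dV" using st by (simp add: dV_def)
  show "(f (s, 0) \<otimes>\<^bsub>D.AG\<^esub> f (t, 0)) [^]\<^bsub>D.AG\<^esub> (m {s, t} div 2) =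
    (f (t, 0) \<otimes>\<^bsub>D.AG\<^esub> f (s, 0)) [^]\<^bsub>D.AG\<^esub> (m {s, t} div 2)" if "s \<in> L" "kap s = 1"
    using D.gen_relation[of "(s, 0)" "(t, 0)"] that st t0 f1 by (simp add: dE_iff dV_def)
  fix i assume si: "(s, i) \<in> dV" and m2: "m {s, t} = 2"
  have s: "s \<in> L" using si by (simp add: dV_def)
  have "D.gen (t, 0) \<otimes>\<^bsub>D.AG\<^esub> f (s, i) = f (s, i) \<otimes>\<^bsub>D.AG\<^esub> D.gen (t, 0)"
  proof (rule D.AG.generate_commute[OF D.gens_closed[OF blk_sub[OF s]] f[OF si, unfolded D.par_def] D.gen_closed[OF t0]])
    fix x assume "x \<in> D.gen ` blk s"
    then obtain j where "x = D.gen (s, j)" "(s, j) \<in> dV" using s by (auto simp: blk_def dV_def)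
    then show "D.gen (t, 0) \<otimes>\<^bsub>D.AG\<^esub> x = x \<otimes>\<^bsub>D.AG\<^esub> D.gen (t, 0)"
      using dgen_comm[OF st(1) _ t0 m2] by simp
  qed
  then show "f (s, i) \<otimes>\<^bsub>D.AG\<^esub> f (t, 0) = f (t, 0) \<otimes>\<^bsub>D.AG\<^esub> f (s, i)"
    using f1 st by simp
qed

text \<open>\<open>dprod t 1 (kap t)\<close> is the counterpart of the middle product
  \<open>p\<close> in \<open>braid_relation_iff\<close>.\<close>

definition dprod :: "'a \<Rightarrow> nat \<Rightarrow> nat \<Rightarrow> ('a \<times> nat) word set" where
  "dprod t a b = D.AG.lprod (map (\<lambda>i. D.gen (t, i)) [a..<b])"

lemma dgen_blk: "j < kap t \<Longrightarrow> D.gen (t, j) \<in> D.par (blk t)"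
  by (intro D.gen_in_par) (auto simp: blk_def)

lemma dprod_blk: "t \<in> L \<Longrightarrow> b \<le> kap t \<Longrightarrow> dprod t a b \<in> D.par (blk t)"
  unfolding dprod_def
  by (intro D.AG.lprod_in_subgroup D.par_subgroup blk_sub) (auto intro: dgen_blk)

lemma dprod_closed: "t \<in> L \<Longrightarrow> b \<le> kap t \<Longrightarrow> dprod t a b \<in> carrier D.AG"
  using dprod_blk D.par_closed[OF blk_sub] by blast

lemma dgen_dV: "t \<in> L \<Longrightarrow> j < kap t \<Longrightarrow> D.gen (t, j) \<in> carrier D.AG"
  by (intro D.gen_closed) (auto simp: dV_def)

definition nxt :: "'a \<times> nat \<Rightarrow> ('a \<times> nat) word set" where
  "nxt = (\<lambda>(t, j). if Suc j < kap t then D.gen (t, Suc j)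
     else inv\<^bsub>D.AG\<^esub> dprod t 1 (kap t) \<otimes>\<^bsub>D.AG\<^esub> D.gen (t, 0) \<otimes>\<^bsub>D.AG\<^esub> dprod t 1 (kap t))"

text \<open>For j = 0 this solves the rewritten relation with all indices lowered by one, c_0 ...
  c_{k-2} c_{k-1} = c_{-1} c_0 ... c_{k-2}, for c_{-1}.\<close>

definition prv :: "'a \<times> nat \<Rightarrow> ('a \<times> nat) word set" where
  "prv = (\<lambda>(t, j). if 0 < j then D.gen (t, j - 1)
     else dprod t 0 (kap t - 1) \<otimes>\<^bsub>D.AG\<^esub> D.gen (t, kap t - 1) \<otimes>\<^bsub>D.AG\<^esub> inv\<^bsub>D.AG\<^esub> dprod t 0 (kap t - 1))"

lemma shift_exists:
  "\<exists>\<psi>\<in>hom D.AG D.AG. \<forall>x\<in>dV. \<psi> (D.gen x) = nxt x"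
proof (rule block_endo)
  fix t i assume "(t, i) \<in> dV"
  then have t: "t \<in> L" "i < kap t" by (auto simp: dV_def)
  then show "nxt (t, i) \<in> D.par (blk t)"
    using D.par_subgroup[OF blk_sub[OF t(1)]] dprod_blk[of t "kap t" 1] dgen_blk
    by (auto simp: nxt_def intro!: subgroup.m_closed subgroup.m_inv_closed)
next
  fix t assume "t \<in> L" "kap t = 1"
  then show "nxt (t, 0) = D.gen (t, 0)" using dgen_dV[of t 0] by (simp add: nxt_def dprod_def)
qed

lemma unshift_exists:
  "\<exists>\<psi>\<in>hom D.AG D.AG. \<forall>x\<in>dV. \<psi> (D.gen x) = prv x"
proof (rule block_endo)
  fix t i assume "(t, i) \<in> dV"
  then have t: "t \<in> L" "i < kap t" by (auto simp: dV_def)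
  then show "prv (t, i) \<in> D.par (blk t)"
    using D.par_subgroup[OF blk_sub[OF t(1)]] dprod_blk[of t "kap t - 1" 0] dgen_blk
    by (auto simp: prv_def intro!: subgroup.m_closed subgroup.m_inv_closed)
next
  fix t assume "t \<in> L" "kap t = 1"
  then show "prv (t, 0) = D.gen (t, 0)" using dgen_dV[of t 0] by (simp add: prv_def dprod_def)
qed

definition shift where
  "shift = (SOME \<psi>. \<psi> \<in> hom D.AG D.AG \<and> (\<forall>x\<in>dV. \<psi> (D.gen x) = nxt x))"

definition unshift where
  "unshift = (SOME \<psi>. \<psi> \<in> hom D.AG D.AG \<and> (\<forall>x\<in>dV. \<psi> (D.gen x) = prv x))"

lemma shift: "shift \<in> hom D.AG D.AG" "x \<in> dV \<Longrightarrow> shift (D.gen x) = nxt x"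
  using someI_ex[of "\<lambda>\<psi>. \<psi> \<in> hom D.AG D.AG \<and> (\<forall>x\<in>dV. \<psi> (D.gen x) = nxt x)"] shift_exists
  unfolding shift_def by blast+

lemma unshift: "unshift \<in> hom D.AG D.AG" "x \<in> dV \<Longrightarrow> unshift (D.gen x) = prv x"
  using someI_ex[of "\<lambda>\<psi>. \<psi> \<in> hom D.AG D.AG \<and> (\<forall>x\<in>dV. \<psi> (D.gen x) = prv x)"] unshift_exists
  unfolding unshift_def by blast+

sublocale sh: group_hom D.AG D.AG shift using shift(1) by unfold_locales
sublocale un: group_hom D.AG D.AG unshift using unshift(1) by unfold_locales

lemma hom_dprod:
  assumes "t \<in> L" "b \<le> kap t" "group Q" "h \<in> hom D.AG Q"
  shows "h (dprod t a b) = monoid.lprod Q (map (\<lambda>i. h (D.gen (t, i))) [a..<b])"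
proof -
  have "set (map (\<lambda>i. D.gen (t, i)) [a..<b]) \<subseteq> carrier D.AG"
    using assms dgen_dV by auto
  from D.AG.lprod_hom[OF assms(3,4) this] show ?thesis by (simp add: dprod_def comp_def)
qed

text \<open>The product stops at index \<open>kap t - 2\<close>, so each factor moves to the next
  copy and the conjugating case of \<open>nxt\<close> does not arise.\<close>

lemma shift_dprod: assumes "t \<in> L" shows "shift (dprod t 0 (kap t - 1)) = dprod t 1 (kap t)"
proof -
  have "map (\<lambda>i. shift (D.gen (t, i))) [0..<kap t - 1] = map (\<lambda>i. D.gen (t, Suc i)) [0..<kap t - 1]"
    using assms shift(2) by (auto simp: dV_def nxt_def)
  also have "\<dots> = map (\<lambda>i. D.gen (t, i)) (map Suc [0..<kap t - 1])" by (simp add: comp_def)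
  also have "map Suc [0..<kap t - 1] = [1..<kap t]" using kap_pos[OF assms] by (simp add: map_Suc_upt)
  finally show ?thesis using hom_dprod[OF assms _ D.AG.is_group shift(1), of "kap t - 1" 0] by (simp add: dprod_def)
qed

lemma unshift_dprod: assumes "t \<in> L" shows "unshift (dprod t 1 (kap t)) = dprod t 0 (kap t - 1)"
proof -
  have "map (\<lambda>i. unshift (D.gen (t, i))) [1..<kap t] = map (\<lambda>i. D.gen (t, i - 1)) [1..<kap t]"
    using assms unshift(2) by (auto simp: dV_def prv_def)
  also have "\<dots> = map (\<lambda>i. D.gen (t, i - 1)) (map Suc [0..<kap t - 1])"
    using kap_pos[OF assms] by (simp add: map_Suc_upt)
  also have "\<dots> = map (\<lambda>i. D.gen (t, i)) [0..<kap t - 1]" by simp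
  finally show ?thesis using hom_dprod[OF assms _ D.AG.is_group unshift(1), of "kap t" 1]
    by (simp add: dprod_def)
qed

text \<open>Checked on generators. Only the copy with index 0 is delicate:
  \<open>shift_dprod\<close> matches the conjugators of \<open>prv\<close> and \<open>nxt\<close>,
  which then cancel.\<close>

lemma shift_unshift: assumes "d \<in> carrier D.AG" shows "shift (unshift d) = d"
proof -
  have "(shift \<circ> unshift) d = id d"
  proof (rule hom_eq_on_generate[where f = "shift \<circ> unshift" and g = id, OF D.AG.is_group D.AG.is_group _ _ D.gens_closed[of dV]])
    show "shift \<circ> unshift \<in> hom D.AG D.AG" by (rule hom_compose[OF unshift(1) shift(1)])
    show "id \<in> hom D.AG D.AG" by (auto simp: hom_def)
    show "d \<in> generate D.AG (D.gen ` dV)" using assms D.carrier_eq_par by (simp add: D.par_def)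
    fix x assume "x \<in> D.gen ` dV"
    then obtain t j where x: "x = D.gen (t, j)" "(t, j) \<in> dV" "t \<in> L" "j < kap t"
      by (auto simp: dV_def)
    let ?P = "dprod t 1 (kap t)"
    have cl: "?P \<in> carrier D.AG" "D.gen (t, 0) \<in> carrier D.AG" "dprod t 0 (kap t - 1) \<in> carrier D.AG"
      "D.gen (t, kap t - 1) \<in> carrier D.AG"
      using x kap_pos[of t] by (auto intro: dprod_closed dgen_dV)
    have last: "shift (D.gen (t, kap t - 1)) = inv\<^bsub>D.AG\<^esub> ?P \<otimes>\<^bsub>D.AG\<^esub> D.gen (t, 0) \<otimes>\<^bsub>D.AG\<^esub> ?P"
      using shift(2)[of "(t, kap t - 1)"] x kap_pos[of t] by (simp add: dV_def nxt_def)
    show "(shift \<circ> unshift) x = id x"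
    proof (cases "0 < j")
      case True
      then have "unshift x = D.gen (t, j - 1)" "(t, j - 1) \<in> dV" using x unshift(2) by (auto simp: prv_def dV_def)
      then show ?thesis using True x shift(2) by (simp add: nxt_def)
    next
      case False
      then have "shift (unshift x) = ?P \<otimes>\<^bsub>D.AG\<^esub> (inv\<^bsub>D.AG\<^esub> ?P \<otimes>\<^bsub>D.AG\<^esub> D.gen (t, 0) \<otimes>\<^bsub>D.AG\<^esub> ?P) \<otimes>\<^bsub>D.AG\<^esub> inv\<^bsub>D.AG\<^esub> ?P"
        using x cl unshift(2) last shift_dprod by (simp add: prv_def)
      also have "\<dots> = D.gen (t, 0)" by (rule D.AG.conj_cancel(1)[OF cl(1,2)])
      finally show ?thesis using cl False x by simp
    qed
  qed simp
  then show ?thesis by simp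
qed

lemma unshift_shift: assumes "d \<in> carrier D.AG" shows "unshift (shift d) = d"
proof -
  have "(unshift \<circ> shift) d = id d"
  proof (rule hom_eq_on_generate[where f = "unshift \<circ> shift" and g = id, OF D.AG.is_group D.AG.is_group _ _ D.gens_closed[of dV]])
    show "unshift \<circ> shift \<in> hom D.AG D.AG" by (rule hom_compose[OF shift(1) unshift(1)])
    show "id \<in> hom D.AG D.AG" by (auto simp: hom_def)
    show "d \<in> generate D.AG (D.gen ` dV)" using assms D.carrier_eq_par by (simp add: D.par_def)
    fix x assume "x \<in> D.gen ` dV"
    then obtain t j where x: "x = D.gen (t, j)" "(t, j) \<in> dV" "t \<in> L" "j < kap t"
      by (auto simp: dV_def)
    let ?Q = "dprod t 0 (kap t - 1)" and ?u = "D.gen (t, kap t - 1)"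
    have cl: "?Q \<in> carrier D.AG" "D.gen (t, 0) \<in> carrier D.AG" "dprod t 1 (kap t) \<in> carrier D.AG"
      "?u \<in> carrier D.AG"
      using x kap_pos[of t] by (auto intro: dprod_closed dgen_dV)
    have first: "unshift (D.gen (t, 0)) = ?Q \<otimes>\<^bsub>D.AG\<^esub> ?u \<otimes>\<^bsub>D.AG\<^esub> inv\<^bsub>D.AG\<^esub> ?Q"
      using unshift(2)[of "(t, 0)"] x kap_pos[of t] by (simp add: dV_def prv_def)
    show "(unshift \<circ> shift) x = id x"
    proof (cases "Suc j < kap t")
      case True
      then have "shift x = D.gen (t, Suc j)" "(t, Suc j) \<in> dV" using x shift(2) by (auto simp: nxt_def dV_def)
      then show ?thesis using True x unshift(2) by (simp add: prv_def)
    next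
      case False
      then have "unshift (shift x) = inv\<^bsub>D.AG\<^esub> ?Q \<otimes>\<^bsub>D.AG\<^esub> (?Q \<otimes>\<^bsub>D.AG\<^esub> ?u \<otimes>\<^bsub>D.AG\<^esub> inv\<^bsub>D.AG\<^esub> ?Q) \<otimes>\<^bsub>D.AG\<^esub> ?Q"
        using x cl shift(2) first unshift_dprod by (simp add: nxt_def)
      also have "\<dots> = ?u" by (rule D.AG.conj_cancel(2)[OF cl(1,4)])
      finally have "unshift (shift x) = ?u" .
      moreover have "kap t - 1 = j" using False x by simp
      ultimately show ?thesis using x by simp
    qed
  qed simp
  then show ?thesis by simp
qed

end

section \<open>The star group: embedding of the copies, permutation representation, exponent
  sum\<close>

context eafc_cone
begin

abbreviation gv where "gv \<equiv> gen v"

lemma gv_closed: "gv \<in> carrier AG" using v by (rule gen_closed)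

lemma gen_L: "t \<in> L \<Longrightarrow> gen t \<in> carrier AG" using gen_closed L_sub by blast

lemma m2_comm:
  assumes "{s, t} \<in> E" "m {s, t} = 2"
  shows "gen s \<otimes>\<^bsub>AG\<^esub> gen t = gen t \<otimes>\<^bsub>AG\<^esub> gen s"
  using gen_relation[OF assms(1)] assms edge_in gen_closed by simp

text \<open>A vertex t with a single copy commutes with v; if it also commutes with s, it commutes
  with the subgroup generated by v and s and thus with all conjugates of s by powers of v.\<close>

lemma emb_exists:
  "\<exists>\<theta>\<in>hom D.AG AG. \<forall>x\<in>dV. \<theta> (D.gen x) = (case x of (t, j) \<Rightarrow> AG.conj_pow gv (gen t) j)"
proof (rule dup_hom[OF AG.is_group])
  fix x assume "x \<in> dV"
  then show "(case x of (t, j) \<Rightarrow> AG.conj_pow gv (gen t) j) \<in> carrier AG"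
    using gv_closed gen_L by (auto simp: dV_def)
next
  fix s t assume "{s, t} \<in> E" "s \<in> L" "t \<in> L"
  then show "((case (s, 0) of (t, j) \<Rightarrow> AG.conj_pow gv (gen t) j) \<otimes>\<^bsub>AG\<^esub>
      (case (t, 0) of (t, j) \<Rightarrow> AG.conj_pow gv (gen t) j)) [^]\<^bsub>AG\<^esub> (m {s, t} div 2) =
    ((case (t, 0) of (t, j) \<Rightarrow> AG.conj_pow gv (gen t) j) \<otimes>\<^bsub>AG\<^esub>
      (case (s, 0) of (t, j) \<Rightarrow> AG.conj_pow gv (gen t) j)) [^]\<^bsub>AG\<^esub> (m {s, t} div 2)"
    using gen_L gen_relation by (simp add: AG.conj_pow_0)
next
  fix s t i assume st: "{s, t} \<in> E" "(s, i) \<in> dV" "t \<in> L" "kap t = 1" "m {s, t} = 2"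
  have s: "s \<in> L" using st by (simp add: dV_def)
  let ?S = "{gv, gen s}"
  have S: "?S \<subseteq> carrier AG" using gv_closed gen_L[OF s] by simp
  have "AG.conj_pow gv (gen s) i \<in> generate AG ?S"
  proof (induction i)
    case 0
    then show ?case using gen_L[OF s] by (simp add: AG.conj_pow_0 generate.incl)
  next
    case (Suc i)
    then show ?case using gv_closed gen_L[OF s]
      by (simp add: AG.conj_pow_Suc generate.incl generate.inv generate.eng)
  qed
  moreover have "gen t \<otimes>\<^bsub>AG\<^esub> x = x \<otimes>\<^bsub>AG\<^esub> gen t" if "x \<in> ?S" for x
    using that m2_comm[OF L[OF st(3)]] m2_comm[OF st(1,5)] m_kap[OF st(3)] st(4) by auto
  ultimately have "gen t \<otimes>\<^bsub>AG\<^esub> AG.conj_pow gv (gen s) i = AG.conj_pow gv (gen s) i \<otimes>\<^bsub>AG\<^esub> gen t"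
    using AG.generate_commute[OF S _ gen_L[OF st(3)]] by blast
  then show "(case (s, i) of (t, j) \<Rightarrow> AG.conj_pow gv (gen t) j) \<otimes>\<^bsub>AG\<^esub>
      (case (t, 0) of (t, j) \<Rightarrow> AG.conj_pow gv (gen t) j) =
    (case (t, 0) of (t, j) \<Rightarrow> AG.conj_pow gv (gen t) j) \<otimes>\<^bsub>AG\<^esub>
      (case (s, i) of (t, j) \<Rightarrow> AG.conj_pow gv (gen t) j)"
    using gen_L[OF st(3)] by (simp add: AG.conj_pow_0)
qed

definition emb where
  "emb = (SOME \<theta>. \<theta> \<in> hom D.AG AG \<and>
    (\<forall>x\<in>dV. \<theta> (D.gen x) = (case x of (t, j) \<Rightarrow> AG.conj_pow gv (gen t) j)))"

lemma emb: "emb \<in> hom D.AG AG" "(t, j) \<in> dV \<Longrightarrow> emb (D.gen (t, j)) = AG.conj_pow gv (gen t) j"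
  using someI_ex[of "\<lambda>\<theta>. \<theta> \<in> hom D.AG AG \<and>
    (\<forall>x\<in>dV. \<theta> (D.gen x) = (case x of (t, j) \<Rightarrow> AG.conj_pow gv (gen t) j))"] emb_exists
  unfolding emb_def by fastforce+

sublocale ba: group_hom D.AG AG emb using emb(1) by unfold_locales

lemma emb_0: "t \<in> L \<Longrightarrow> emb (D.gen (t, 0)) = gen t"
  using emb(2)[of t 0] kap_pos[of t] gen_L by (simp add: dV_def AG.conj_pow_0)

lemma gv_relation:
  assumes "t \<in> L"
  shows "(gv \<otimes>\<^bsub>AG\<^esub> gen t) [^]\<^bsub>AG\<^esub> kap t = (gen t \<otimes>\<^bsub>AG\<^esub> gv) [^]\<^bsub>AG\<^esub> kap t"
  using gen_relation[OF L[OF assms]] by (simp add: kap_def)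

lemma gens_dV: "d \<in> carrier D.AG \<Longrightarrow> d \<in> generate D.AG (D.gen ` dV)"
  using D.carrier_eq_par by (simp add: D.par_def)

text \<open>On all but the last copy, conjugation by \<open>v\<close> raises the exponent by one; on
  the last copy the claim is the relation between \<open>v\<close> and \<open>t\<close> in the form
  given by \<open>braid_relation_iff\<close>.\<close>

lemma emb_shift:
  assumes "d \<in> carrier D.AG"
  shows "gv \<otimes>\<^bsub>AG\<^esub> emb d = emb (shift d) \<otimes>\<^bsub>AG\<^esub> gv"
proof -
  have "(emb \<circ> shift) d = (\<lambda>d. gv \<otimes>\<^bsub>AG\<^esub> emb d \<otimes>\<^bsub>AG\<^esub> inv\<^bsub>AG\<^esub> gv) d"
  proof (rule hom_eq_on_generate[where f = "emb \<circ> shift", OF D.AG.is_group AG.is_group _ _ D.gens_closed[OF subset_refl] _ gens_dV[OF assms]])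
    show "emb \<circ> shift \<in> hom D.AG AG" by (rule hom_compose[OF shift(1) emb(1)])
    show "(\<lambda>d. gv \<otimes>\<^bsub>AG\<^esub> emb d \<otimes>\<^bsub>AG\<^esub> inv\<^bsub>AG\<^esub> gv) \<in> hom D.AG AG"
    proof (rule homI)
      fix x y assume xy: "x \<in> carrier D.AG" "y \<in> carrier D.AG"
      have "inv\<^bsub>AG\<^esub> gv \<otimes>\<^bsub>AG\<^esub> (gv \<otimes>\<^bsub>AG\<^esub> (emb y \<otimes>\<^bsub>AG\<^esub> inv\<^bsub>AG\<^esub> gv)) = emb y \<otimes>\<^bsub>AG\<^esub> inv\<^bsub>AG\<^esub> gv"
        using xy gv_closed by (simp flip: AG.m_assoc)
      then show "gv \<otimes>\<^bsub>AG\<^esub> emb (x \<otimes>\<^bsub>D.AG\<^esub> y) \<otimes>\<^bsub>AG\<^esub> inv\<^bsub>AG\<^esub> gv =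
        gv \<otimes>\<^bsub>AG\<^esub> emb x \<otimes>\<^bsub>AG\<^esub> inv\<^bsub>AG\<^esub> gv \<otimes>\<^bsub>AG\<^esub> (gv \<otimes>\<^bsub>AG\<^esub> emb y \<otimes>\<^bsub>AG\<^esub> inv\<^bsub>AG\<^esub> gv)"
        using xy gv_closed by (simp add: AG.m_assoc)
    qed (use gv_closed in simp)
    fix x assume "x \<in> D.gen ` dV"
    then obtain t j where x: "x = D.gen (t, j)" "(t, j) \<in> dV" "t \<in> L" "j < kap t"
      by (auto simp: dV_def)
    let ?c = "AG.conj_pow gv (gen t)"
    have gt: "gen t \<in> carrier AG" using gen_L x by blast
    have "emb (nxt (t, j)) = ?c (Suc j)"
    proof (cases "Suc j < kap t")
      case True
      then show ?thesis using emb(2)[of t "Suc j"] x by (simp add: nxt_def dV_def)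
    next
      case False
      then have j: "Suc j = kap t" using x by simp
      define P where "P = AG.lprod (map ?c [1..<kap t])"
      have mp: "map (\<lambda>i. emb (D.gen (t, i))) [1..<kap t] = map ?c [1..<kap t]"
        using emb(2) x by (auto simp: dV_def)
      then have bP: "emb (dprod t 1 (kap t)) = P"
        using hom_dprod[OF x(3) order_refl AG.is_group emb(1), of 1] by (simp only: P_def mp)
      have Pc: "P \<in> carrier AG" unfolding P_def using gt gv_closed by (intro AG.lprod_closed) auto
      have "P \<otimes>\<^bsub>AG\<^esub> ?c (kap t) = gen t \<otimes>\<^bsub>AG\<^esub> P"
        using AG.braid_relation_iff[OF gv_closed gt kap_pos[OF x(3)]] gv_relation[OF x(3)] by (simp add: P_def)
      then have "?c (kap t) = inv\<^bsub>AG\<^esub> P \<otimes>\<^bsub>AG\<^esub> (gen t \<otimes>\<^bsub>AG\<^esub> P)"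
        using Pc gt gv_closed by (metis AG.conj_pow_closed AG.inv_solve_left AG.m_closed)
      moreover have "dprod t 1 (kap t) \<in> carrier D.AG" "D.gen (t, 0) \<in> carrier D.AG"
        using dprod_closed dgen_dV kap_pos x(3) by auto
      ultimately show ?thesis using False j bP emb_0[OF x(3)] Pc gt by (simp add: nxt_def AG.m_assoc)
    qed
    then show "(emb \<circ> shift) x = gv \<otimes>\<^bsub>AG\<^esub> emb x \<otimes>\<^bsub>AG\<^esub> inv\<^bsub>AG\<^esub> gv"
      using x shift(2) emb(2) AG.conj_pow_Suc[OF gv_closed gt] by simp
  qed
  then show ?thesis using assms gv_closed by (simp add: AG.m_assoc)
qed

text \<open>The group on the star acts on the underlying set of \<open>D.AG\<close>: \<open>v\<close> by \<open>shift\<close> and \<open>t \<in> L\<close> by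
  left translation. Outside the carrier the maps are the identity, so that they are bijections of
  the whole type.\<close>

definition ltrans :: "('a \<times> nat) word set \<Rightarrow> ('a \<times> nat) word set \<Rightarrow> ('a \<times> nat) word set" where
  "ltrans d x = (if x \<in> carrier D.AG then d \<otimes>\<^bsub>D.AG\<^esub> x else x)"

definition shp :: "('a \<times> nat) word set \<Rightarrow> ('a \<times> nat) word set" where
  "shp x = (if x \<in> carrier D.AG then shift x else x)"

sublocale Q: group "perm_group :: (('a \<times> nat) word set \<Rightarrow> ('a \<times> nat) word set) monoid"
  by (rule group_perm_group)

lemma ltrans_hom: "ltrans \<in> hom D.AG perm_group"
proof (rule homI)
  show "ltrans (x \<otimes>\<^bsub>D.AG\<^esub> y) = ltrans x \<otimes>\<^bsub>perm_group\<^esub> ltrans y"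
    if "x \<in> carrier D.AG" "y \<in> carrier D.AG" for x y
    using that by (auto simp: ltrans_def fun_eq_iff D.AG.m_assoc)
  fix x assume x: "x \<in> carrier D.AG"
  have "ltrans x \<circ> ltrans (inv\<^bsub>D.AG\<^esub> x) = id" "ltrans (inv\<^bsub>D.AG\<^esub> x) \<circ> ltrans x = id"
    using x by (auto simp: ltrans_def fun_eq_iff simp flip: D.AG.m_assoc)
  then show "ltrans x \<in> carrier perm_group" by (simp add: o_bij)
qed

sublocale lt: group_hom D.AG perm_group ltrans using ltrans_hom by unfold_locales

lemma shp_closed: "shp \<in> carrier perm_group"
proof -
  have "shp \<circ> (\<lambda>x. if x \<in> carrier D.AG then unshift x else x) = id"
    "(\<lambda>x. if x \<in> carrier D.AG then unshift x else x) \<circ> shp = id"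
    by (auto simp: shp_def fun_eq_iff shift_unshift unshift_shift)
  then show ?thesis by (simp add: o_bij)
qed

lemma shp_ltrans:
  assumes "d \<in> carrier D.AG"
  shows "shp \<otimes>\<^bsub>perm_group\<^esub> ltrans d = ltrans (shift d) \<otimes>\<^bsub>perm_group\<^esub> shp"
  using assms by (auto simp: shp_def ltrans_def fun_eq_iff)

lemma shp_conj:
  assumes "d \<in> carrier D.AG"
  shows "shp \<otimes>\<^bsub>perm_group\<^esub> ltrans d \<otimes>\<^bsub>perm_group\<^esub> inv\<^bsub>perm_group\<^esub> shp = ltrans (shift d)"
  unfolding shp_ltrans[OF assms]
  using shp_closed lt.hom_closed[OF sh.hom_closed[OF assms]] by (simp add: Q.m_assoc del: perm_group_simps)

text \<open>Conjugating the translation by copy 0 with powers of \<open>shp\<close> gives the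
  translations by the successive copies. The conjugate number \<open>kap t\<close> is given by the
  last case of \<open>nxt\<close>, which is what \<open>braid_relation_iff\<close> asks for.\<close>

lemma shp_relation:
  assumes t: "t \<in> L"
  shows "(shp \<otimes>\<^bsub>perm_group\<^esub> ltrans (D.gen (t, 0))) [^]\<^bsub>perm_group\<^esub> kap t =
    (ltrans (D.gen (t, 0)) \<otimes>\<^bsub>perm_group\<^esub> shp) [^]\<^bsub>perm_group\<^esub> kap t"
proof -
  let ?c = "Q.conj_pow shp (ltrans (D.gen (t, 0)))"
  have g0: "D.gen (t, 0) \<in> carrier D.AG" by (rule dgen_dV[OF t kap_pos[OF t]])
  then have l0: "ltrans (D.gen (t, 0)) \<in> carrier perm_group" by (rule lt.hom_closed)
  have c: "?c j = ltrans (D.gen (t, j))" if "j < kap t" for j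
    using that
  proof (induction j)
    case 0
    show ?case by (rule Q.conj_pow_0[OF l0])
  next
    case (Suc j)
    then have "shift (D.gen (t, j)) = D.gen (t, Suc j)"
      using shift(2)[of "(t, j)"] t by (simp add: dV_def nxt_def)
    then show ?case
      using Suc shp_conj[OF dgen_dV[OF t, of j]] Q.conj_pow_Suc[OF shp_closed l0] by simp
  qed
  define P where "P = dprod t 1 (kap t)"
  have P: "P \<in> carrier D.AG" using dprod_closed[OF t] by (simp add: P_def)
  obtain j where j: "kap t = Suc j" using kap_pos[OF t] gr0_conv_Suc by auto
  have "?c (kap t) = ltrans (shift (D.gen (t, j)))"
    unfolding j using Q.conj_pow_Suc[OF shp_closed l0, of j] c[of j] shp_conj[OF dgen_dV[OF t, of j]] j by simp
  also have "shift (D.gen (t, j)) = inv\<^bsub>D.AG\<^esub> P \<otimes>\<^bsub>D.AG\<^esub> D.gen (t, 0) \<otimes>\<^bsub>D.AG\<^esub> P"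
    using shift(2)[of "(t, j)"] t j by (simp add: dV_def nxt_def P_def)
  finally have ck: "?c (kap t) = ltrans (inv\<^bsub>D.AG\<^esub> P \<otimes>\<^bsub>D.AG\<^esub> D.gen (t, 0) \<otimes>\<^bsub>D.AG\<^esub> P)" .
  have mp: "map (\<lambda>i. ltrans (D.gen (t, i))) [1..<kap t] = map ?c [1..<kap t]"
    using c by auto
  then have lP: "Q.lprod (map ?c [1..<kap t]) = ltrans P"
    using hom_dprod[OF t order_refl Q.is_group ltrans_hom, of 1] by (simp only: P_def mp)
  have "P \<otimes>\<^bsub>D.AG\<^esub> (inv\<^bsub>D.AG\<^esub> P \<otimes>\<^bsub>D.AG\<^esub> D.gen (t, 0) \<otimes>\<^bsub>D.AG\<^esub> P) = D.gen (t, 0) \<otimes>\<^bsub>D.AG\<^esub> P"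
    using P g0 by (simp flip: D.AG.m_assoc)
  then have "ltrans P \<otimes>\<^bsub>perm_group\<^esub> ?c (kap t) = ltrans (D.gen (t, 0)) \<otimes>\<^bsub>perm_group\<^esub> ltrans P"
    unfolding ck using P g0 by (simp only: D.AG.m_closed D.AG.inv_closed flip: lt.hom_mult)
  then show ?thesis
    using Q.braid_relation_iff[OF shp_closed l0 kap_pos[OF t]] lP by simp
qed

text \<open>The semidirect product of \<open>D.AG\<close> with the integers, acting on
  \<open>D.AG\<close>. It allows an element of \<open>D.AG\<close> to be recovered from its image in
  the Artin group.\<close>

lemma rep_exists:
  "\<exists>\<Phi>\<in>hom AG perm_group. \<Phi> gv = shp \<and> (\<forall>t\<in>L. \<Phi> (gen t) = ltrans (D.gen (t, 0)))"
proof -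
  define f where "f x = (if x = v then shp else if x \<in> L then ltrans (D.gen (x, 0)) else id)" for x
  have fv: "f v = shp" and fL: "\<And>t. t \<in> L \<Longrightarrow> f t = ltrans (D.gen (t, 0))"
    using v_notin by (auto simp: f_def)
  have g0: "D.gen (t, 0) \<in> carrier D.AG" if "t \<in> L" for t by (rule dgen_dV[OF that kap_pos[OF that]])
  have "\<exists>\<Phi>\<in>hom AG perm_group. \<forall>x\<in>V. \<Phi> (gen x) = f x"
  proof (rule universal[OF Q.is_group])
    show "f x \<in> carrier perm_group" for x
      using shp_closed lt.hom_closed[OF g0] by (auto simp: f_def)
    fix a b assume e: "{a, b} \<in> E"
    then have ab: "a \<noteq> b" using edge_in by blast
    consider "a \<notin> insert v L \<or> b \<notin> insert v L" | "a \<in> L" "b \<in> L" | "a = v" "b \<in> L" | "a \<in> L" "b = v"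
      using ab by auto
    then show "(f a \<otimes>\<^bsub>perm_group\<^esub> f b) [^]\<^bsub>perm_group\<^esub> (m {a, b} div 2) =
        (f b \<otimes>\<^bsub>perm_group\<^esub> f a) [^]\<^bsub>perm_group\<^esub> (m {a, b} div 2)"
    proof cases
      case 1
      then have "f a = id \<or> f b = id" by (auto simp: f_def)
      then show ?thesis by auto
    next
      case 2
      have "{(a, 0), (b, 0)} \<in> dE" using 2 e kap_pos by (simp add: dE_iff dV_def)
      from D.gen_relation[OF this]
      have "ltrans ((D.gen (a, 0) \<otimes>\<^bsub>D.AG\<^esub> D.gen (b, 0)) [^]\<^bsub>D.AG\<^esub> (m {a, b} div 2)) =
        ltrans ((D.gen (b, 0) \<otimes>\<^bsub>D.AG\<^esub> D.gen (a, 0)) [^]\<^bsub>D.AG\<^esub> (m {a, b} div 2))" by simp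
      then show ?thesis using 2 g0 fL by (simp add: lt.hom_nat_pow del: perm_group_simps)
    next
      case 3
      then show ?thesis using fv fL shp_relation by (simp add: kap_def del: perm_group_simps)
    next
      case 4
      then show ?thesis using fv fL shp_relation[of a]
        by (simp add: kap_def insert_commute del: perm_group_simps)
    qed
  qed
  then obtain \<Phi> where "\<Phi> \<in> hom AG perm_group" "\<forall>x\<in>V. \<Phi> (gen x) = f x" by blast
  then show ?thesis using fv fL v L_sub by (intro bexI[of _ \<Phi>]) auto
qed

lemma emb_degree:
  assumes \<delta>: "\<delta> \<in> hom AG integer_group" "\<forall>x\<in>V - {v}. \<delta> (gen x) = 0" and d: "d \<in> carrier D.AG"
  shows "\<delta> (emb d) = 0"
proof -
  interpret \<delta>: group_hom AG integer_group \<delta> 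
    using \<delta>(1) by (simp add: group_hom_def group_hom_axioms_def AG.is_group)
  have "(\<delta> \<circ> emb) d = (\<lambda>_. 0) d"
  proof (rule hom_eq_on_generate[where f = "\<delta> \<circ> emb", OF D.AG.is_group group_integer_group _ _ D.gens_closed[OF subset_refl] _ gens_dV[OF d]])
    show "\<delta> \<circ> emb \<in> hom D.AG integer_group" by (rule hom_compose[OF emb(1) \<delta>(1)])
    show "(\<lambda>_. 0) \<in> hom D.AG integer_group" by (auto simp: hom_def)
    fix x assume "x \<in> D.gen ` dV"
    then obtain t j where x: "x = D.gen (t, j)" "(t, j) \<in> dV" "t \<in> L"
      by (auto simp: dV_def)
    have "\<delta> (gen t) = 0" using \<delta>(2) x L_sub v_notin by blast
    then show "(\<delta> \<circ> emb) x = 0"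
      using x emb(2) gv_closed gen_L by (simp add: AG.conj_pow_def)
  qed
  then show ?thesis by simp
qed

abbreviation "L0 \<equiv> (\<lambda>t. (t, 0::nat)) ` L"

lemma L0_sub: "L0 \<subseteq> dV" using kap_pos by (auto simp: dV_def)

text \<open>The exponent sum of \<open>v\<close> forces g = \<open>emb d\<close>. The representation
  turns the membership of g^n in \<open>par L\<close> into that of d^n in \<open>D.par L0\<close>;
  the hypothesis then applies to d, and \<open>emb\<close> carries the result back.\<close>

lemma cone_root_closed:
  assumes rc: "root_closed D.AG (D.par L0) (carrier D.AG)"
  shows "root_closed AG (par L) (par (insert v L))"
  unfolding root_closed_def
proof (intro ballI allI impI)
  fix g and n :: nat
  assume g: "g \<in> par (insert v L)" and n: "0 < n" and gn: "g [^]\<^bsub>AG\<^esub> n \<in> par L"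
  obtain \<Phi> where \<Phi>: "\<Phi> \<in> hom AG perm_group" "\<Phi> gv = shp" "\<forall>t\<in>L. \<Phi> (gen t) = ltrans (D.gen (t, 0))"
    using rep_exists by blast
  interpret \<Phi>: group_hom AG perm_group \<Phi> using \<Phi>(1) by unfold_locales
  obtain \<delta> where \<delta>: "\<delta> \<in> hom AG integer_group" "\<delta> gv = 1" "\<forall>y\<in>V - {v}. \<delta> (gen y) = 0"
    using degree[OF v] by blast
  interpret \<delta>: group_hom AG integer_group \<delta> 
    using \<delta>(1) by (simp add: group_hom_def group_hom_axioms_def AG.is_group)
  have sub: "insert v L \<subseteq> V" using v L_sub by simp
  have gc: "g \<in> carrier AG" using par_closed[OF sub g] .
  \<comment> \<open>Both factorisations go through one induction, so that the same d serves in the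
    Artin group and among the permutations.\<close>
  define P where "P x \<longleftrightarrow> (\<exists>d\<in>carrier D.AG. \<exists>i::int. x = emb d \<otimes>\<^bsub>AG\<^esub> gv [^]\<^bsub>AG\<^esub> i \<and>
    \<Phi> x = ltrans d \<otimes>\<^bsub>perm_group\<^esub> shp [^]\<^bsub>perm_group\<^esub> i)" for x
  have PI: "P x" if "d \<in> carrier D.AG" "x = emb d \<otimes>\<^bsub>AG\<^esub> gv [^]\<^bsub>AG\<^esub> i"
    "\<Phi> x = ltrans d \<otimes>\<^bsub>perm_group\<^esub> shp [^]\<^bsub>perm_group\<^esub> i" for x d and i :: int
    using that unfolding P_def by blast
  have stepL: "P (emb e \<otimes>\<^bsub>AG\<^esub> x)" if e: "e \<in> carrier D.AG" "\<Phi> (emb e) = ltrans e" and x: "P x" for e x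
  proof -
    obtain d and i :: int where d: "d \<in> carrier D.AG" "x = emb d \<otimes>\<^bsub>AG\<^esub> gv [^]\<^bsub>AG\<^esub> i"
      "\<Phi> x = ltrans d \<otimes>\<^bsub>perm_group\<^esub> shp [^]\<^bsub>perm_group\<^esub> i" using x unfolding P_def by blast
    have xc: "x \<in> carrier AG" using d gv_closed by simp
    show ?thesis
    proof (rule PI[of "e \<otimes>\<^bsub>D.AG\<^esub> d" _ i])
      show "e \<otimes>\<^bsub>D.AG\<^esub> d \<in> carrier D.AG" using e d by simp
      show "emb e \<otimes>\<^bsub>AG\<^esub> x = emb (e \<otimes>\<^bsub>D.AG\<^esub> d) \<otimes>\<^bsub>AG\<^esub> gv [^]\<^bsub>AG\<^esub> i"
        using e d gv_closed by (simp add: AG.m_assoc)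
      have "\<Phi> (emb e \<otimes>\<^bsub>AG\<^esub> x) = ltrans e \<otimes>\<^bsub>perm_group\<^esub> (ltrans d \<otimes>\<^bsub>perm_group\<^esub> shp [^]\<^bsub>perm_group\<^esub> i)"
        using \<Phi>.hom_mult[OF ba.hom_closed[OF e(1)] xc] e(2) d(3) by simp
      also have "\<dots> = ltrans (e \<otimes>\<^bsub>D.AG\<^esub> d) \<otimes>\<^bsub>perm_group\<^esub> shp [^]\<^bsub>perm_group\<^esub> i"
        unfolding lt.hom_mult[OF e(1) d(1)]
        using Q.m_assoc[OF lt.hom_closed[OF e(1)] lt.hom_closed[OF d(1)] Q.int_pow_closed[OF shp_closed]] by simp
      finally show "\<Phi> (emb e \<otimes>\<^bsub>AG\<^esub> x) = ltrans (e \<otimes>\<^bsub>D.AG\<^esub> d) \<otimes>\<^bsub>perm_group\<^esub> shp [^]\<^bsub>perm_group\<^esub> i" .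
    qed
  qed
  have stepv: "P (gv \<otimes>\<^bsub>AG\<^esub> x)" "P (inv\<^bsub>AG\<^esub> gv \<otimes>\<^bsub>AG\<^esub> x)" if x: "P x" for x
  proof -
    obtain d and i :: int where d: "d \<in> carrier D.AG" "x = emb d \<otimes>\<^bsub>AG\<^esub> gv [^]\<^bsub>AG\<^esub> i"
      "\<Phi> x = ltrans d \<otimes>\<^bsub>perm_group\<^esub> shp [^]\<^bsub>perm_group\<^esub> i" using x unfolding P_def by blast
    have xc: "x \<in> carrier AG" using d gv_closed by simp
    show "P (gv \<otimes>\<^bsub>AG\<^esub> x)"
    proof (rule PI[of "shift d" _ "1 + i"])
      show "shift d \<in> carrier D.AG" using d by simp
      then show "gv \<otimes>\<^bsub>AG\<^esub> x = emb (shift d) \<otimes>\<^bsub>AG\<^esub> gv [^]\<^bsub>AG\<^esub> (1 + i)"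
        unfolding d(2) using d(1) by (intro AG.intertwine_int_pow(1) gv_closed emb_shift) auto
      show "\<Phi> (gv \<otimes>\<^bsub>AG\<^esub> x) = ltrans (shift d) \<otimes>\<^bsub>perm_group\<^esub> shp [^]\<^bsub>perm_group\<^esub> (1 + i)"
        unfolding \<Phi>.hom_mult[OF gv_closed xc] \<Phi>(2) d(3) using d(1)
        by (intro Q.intertwine_int_pow(1) shp_closed shp_ltrans lt.hom_closed) auto
    qed
    have u: "unshift d \<in> carrier D.AG" using d by simp
    show "P (inv\<^bsub>AG\<^esub> gv \<otimes>\<^bsub>AG\<^esub> x)"
    proof (rule PI[of "unshift d" _ "- 1 + i"])
      show "unshift d \<in> carrier D.AG" by fact
      have "gv \<otimes>\<^bsub>AG\<^esub> emb (unshift d) = emb d \<otimes>\<^bsub>AG\<^esub> gv"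
        using emb_shift[OF u] shift_unshift[OF d(1)] by simp
      then show "inv\<^bsub>AG\<^esub> gv \<otimes>\<^bsub>AG\<^esub> x = emb (unshift d) \<otimes>\<^bsub>AG\<^esub> gv [^]\<^bsub>AG\<^esub> (- 1 + i)"
        unfolding d(2) using d(1) u by (intro AG.intertwine_int_pow(2) gv_closed) auto
      have "shp \<otimes>\<^bsub>perm_group\<^esub> ltrans (unshift d) = ltrans d \<otimes>\<^bsub>perm_group\<^esub> shp"
        using shp_ltrans[OF u] shift_unshift[OF d(1)] by simp
      then show "\<Phi> (inv\<^bsub>AG\<^esub> gv \<otimes>\<^bsub>AG\<^esub> x) = ltrans (unshift d) \<otimes>\<^bsub>perm_group\<^esub> shp [^]\<^bsub>perm_group\<^esub> (- 1 + i)"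
        unfolding \<Phi>.hom_mult[OF AG.inv_closed[OF gv_closed] xc] \<Phi>.hom_inv[OF gv_closed] \<Phi>(2) d(3)
        by (intro Q.intertwine_int_pow(2) shp_closed lt.hom_closed u d(1))
    qed
  qed
  have stept: "P (gen t \<otimes>\<^bsub>AG\<^esub> x)" "P (inv\<^bsub>AG\<^esub> gen t \<otimes>\<^bsub>AG\<^esub> x)" if t: "t \<in> L" and x: "P x" for t x
  proof -
    have g0: "D.gen (t, 0) \<in> carrier D.AG" by (rule dgen_dV[OF t kap_pos[OF t]])
    have e: "\<Phi> (emb (D.gen (t, 0))) = ltrans (D.gen (t, 0))" using \<Phi>(3) t emb_0 by simp
    show "P (gen t \<otimes>\<^bsub>AG\<^esub> x)" using stepL[OF g0 e x] emb_0[OF t] by simp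
    have "\<Phi> (emb (inv\<^bsub>D.AG\<^esub> D.gen (t, 0))) = ltrans (inv\<^bsub>D.AG\<^esub> D.gen (t, 0))"
      unfolding lt.hom_inv[OF g0] ba.hom_inv[OF g0] \<Phi>.hom_inv[OF ba.hom_closed[OF g0]] e ..
    from stepL[OF D.AG.inv_closed[OF g0] this x] show "P (inv\<^bsub>AG\<^esub> gen t \<otimes>\<^bsub>AG\<^esub> x)"
      using g0 emb_0[OF t] by simp
  qed
  have "P g"
  proof (rule AG.generate_left_induct[OF gens_closed[OF sub] g[unfolded par_def], of P])
    show "P \<one>\<^bsub>AG\<^esub>" by (rule PI[of "\<one>\<^bsub>D.AG\<^esub>" _ 0]) (use lt.hom_one in simp_all)
  qed (use stepv stept in auto)
  then obtain d and i :: int where d: "d \<in> carrier D.AG" "g = emb d \<otimes>\<^bsub>AG\<^esub> gv [^]\<^bsub>AG\<^esub> i"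
    "\<Phi> g = ltrans d \<otimes>\<^bsub>perm_group\<^esub> shp [^]\<^bsub>perm_group\<^esub> i" unfolding P_def by blast
  have \<Phi>L: "\<Phi> h \<in> ltrans ` D.par L0" if h: "h \<in> par L" for h
  proof (rule generate_subset_closed[OF AG.is_group Q.is_group \<Phi>(1) gens_closed[OF L_sub]])
    show "subgroup (ltrans ` D.par L0) perm_group"
      by (rule lt.subgroup_img_is_subgroup[OF D.par_subgroup[OF L0_sub]])
    show "h \<in> generate AG (gen ` L)" using h by (simp add: par_def)
    show "\<Phi> s \<in> ltrans ` D.par L0" if "s \<in> gen ` L" for s
      using that \<Phi>(3) D.gen_in_par[of _ L0] by auto
  qed
  have \<delta>L: "\<delta> h = 0" if h: "h \<in> par L" for h
  proof -
    have "\<delta> h \<in> {\<one>\<^bsub>integer_group\<^esub>}"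
      by (rule generate_subset_closed[OF AG.is_group group_integer_group \<delta>(1) gens_closed[OF L_sub]
            group.triv_subgroup[OF group_integer_group] _ h[unfolded par_def]])
        (use v_notin L_sub \<delta>(3) in auto)
    then show ?thesis by simp
  qed
  have "\<delta> g = i"
    using d(1,2) gv_closed emb_degree[OF \<delta>(1,3) d(1)] \<delta>.hom_int_pow[OF gv_closed, of i] \<delta>(2) by simp
  moreover have "\<delta> g [^]\<^bsub>integer_group\<^esub> n = 0"
    using \<delta>L[OF gn] \<delta>.hom_nat_pow[OF gc, of n] by simp
  ultimately have "i = 0" using n by (simp flip: int_pow_int)
  then have gd: "g = emb d" "\<Phi> g = ltrans d"
    using d gv_closed by (simp_all)
  obtain d' where d': "d' \<in> D.par L0" "\<Phi> (g [^]\<^bsub>AG\<^esub> n) = ltrans d'" using \<Phi>L[OF gn] by blast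
  have d'c: "d' \<in> carrier D.AG" using d'(1) D.par_closed[OF L0_sub] by blast
  have "ltrans (d [^]\<^bsub>D.AG\<^esub> n) = ltrans d'"
    using lt.hom_nat_pow[OF d(1), of n] \<Phi>.hom_nat_pow[OF gc, of n] gd d'(2) by simp
  \<comment> \<open>A left translation is determined by its value at the identity.\<close>
  then have "ltrans (d [^]\<^bsub>D.AG\<^esub> n) \<one>\<^bsub>D.AG\<^esub> = ltrans d' \<one>\<^bsub>D.AG\<^esub>" by simp
  then have "d [^]\<^bsub>D.AG\<^esub> n = d'" using d(1) d'c by (simp add: ltrans_def)
  then have "d \<in> D.par L0" using root_closedD[OF rc d(1) n] d'(1) by simp
  then show "g \<in> par L"
    unfolding gd(1) D.par_def
    by (rule generate_subset_closed[OF D.AG.is_group AG.is_group emb(1) D.gens_closed[OF L0_sub] par_subgroup[OF L_sub], rotated])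
      (auto simp: emb_0 gen_in_par)
qed

text \<open>On the generators from \<open>L\<close> this is inverted by \<open>emb\<close>, which is
  what \<open>root_closed_transfer\<close> requires in order to move statements about
  \<open>L\<close> to the zeroth copies.\<close>

lemma forth_exists: "\<exists>\<phi>\<in>hom AG D.AG. \<forall>t\<in>L. \<phi> (gen t) = D.gen (t, 0)"
proof -
  define f where "f x = (if x \<in> L then D.gen (x, 0) else \<one>\<^bsub>D.AG\<^esub>)" for x
  have fc: "f x \<in> carrier D.AG" for x using dgen_dV[OF _ kap_pos] by (simp add: f_def)
  have "\<exists>\<phi>\<in>hom AG D.AG. \<forall>x\<in>V. \<phi> (gen x) = f x"
  proof (rule universal[OF D.AG.is_group fc])
    fix a b assume e: "{a, b} \<in> E"
    show "(f a \<otimes>\<^bsub>D.AG\<^esub> f b) [^]\<^bsub>D.AG\<^esub> (m {a, b} div 2) = (f b \<otimes>\<^bsub>D.AG\<^esub> f a) [^]\<^bsub>D.AG\<^esub> (m {a, b} div 2)"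
    proof (cases "a \<in> L \<and> b \<in> L")
      case True
      then have "{(a, 0), (b, 0)} \<in> dE" using e kap_pos by (simp add: dE_iff dV_def)
      from D.gen_relation[OF this] show ?thesis using True by (simp add: f_def)
    next
      case False
      then have "f a = \<one>\<^bsub>D.AG\<^esub> \<or> f b = \<one>\<^bsub>D.AG\<^esub>" by (auto simp: f_def)
      then show ?thesis using fc[of a] fc[of b] by auto
    qed
  qed
  then obtain \<phi> where "\<phi> \<in> hom AG D.AG" "\<forall>x\<in>V. \<phi> (gen x) = f x" by blast
  then show ?thesis using L_sub by (intro bexI[of _ \<phi>]) (auto simp: f_def)
qed

text \<open>An extra copy (u, j) has j > 0, so u has several copies and each neighbour of u in
  \<open>L\<close> has just one: the neighbours of (u, j) are the zeroth copies \<open>?N0\<close>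
  of the link of u in \<open>L\<close>, all with label 2. Their group is root-closed in the group
  with (u, j) adjoined, where that copy is central, and in the group on \<open>L0 \<union> T\<close>
  by \<open>rc\<close> and the induction hypothesis. The amalgam over it then adjoins the
  copy.\<close>

lemma duplicates_root_closed:
  assumes rc: "\<And>u. u \<in> L \<Longrightarrow> root_closed AG (par {t \<in> L. {u, t} \<in> E}) (par L)"
    and T: "finite T" "T \<subseteq> dV - L0"
  shows "root_closed D.AG (D.par L0) (D.par (L0 \<union> T))"
  using T
proof (induction T)
  case empty
  show ?case by (simp add: root_closed_def)
next
  case (insert x T)
  obtain u j where x: "x = (u, j)" by force
  have u: "u \<in> L" "j < kap u" "0 < j" "(u, j) \<in> dV" using insert.prems by (auto simp: x dV_def image_iff)
  define N where "N = {t \<in> L. {u, t} \<in> E}"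
  let ?N0 = "(\<lambda>t. (t, 0::nat)) ` N"
  have N: "N \<subseteq> L" by (auto simp: N_def)
  have kN: "kap t = 1" "m {u, t} = 2" if "t \<in> N" for t
    using kap_edge[of u t] that u by (auto simp: N_def)
  have N0: "?N0 \<subseteq> dV" "?N0 \<subseteq> L0" using N L0_sub by auto
  have x_notin: "x \<notin> L0 \<union> T" using insert by auto
  have IH: "root_closed D.AG (D.par L0) (D.par (L0 \<union> T))" using insert by auto
  have "root_closed D.AG (D.par ?N0) (D.par L0)"
  proof -
    obtain \<phi> where \<phi>: "\<phi> \<in> hom AG D.AG" "\<forall>t\<in>L. \<phi> (gen t) = D.gen (t, 0)" using forth_exists by blast
    have im: "\<phi> ` gen ` S = D.gen ` (\<lambda>t. (t, 0)) ` S" if "S \<subseteq> L" for S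
      using \<phi>(2) that by (force simp: image_iff)
    have "root_closed D.AG (generate D.AG (\<phi> ` gen ` N)) (generate D.AG (\<phi> ` gen ` L))"
    proof (rule root_closed_transfer[OF AG.is_group D.AG.is_group \<phi>(1) emb(1) _ gens_closed[OF L_sub]])
      show "root_closed AG (generate AG (gen ` N)) (generate AG (gen ` L))"
        using rc[OF u(1)] by (simp add: par_def N_def)
    qed (use N \<phi>(2) emb_0 in auto)
    then show ?thesis unfolding im[OF N] im[OF subset_refl] D.par_def .
  qed
  then have 1: "root_closed D.AG (D.par ?N0) (D.par (L0 \<union> T))"
    using root_closed_trans[OF _ IH] D.par_mono[OF N0(2)] by blast
  have xN: "x \<notin> ?N0" using x_notin N0 by blast
  have 2: "root_closed D.AG (D.par ?N0) (D.par (insert x ?N0))"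
  proof (rule D.central_root_closed[OF _ xN N0(1)])
    show "x \<in> dV" using x u by simp
    fix t assume "t \<in> ?N0"
    then show "{x, t} \<in> dE \<and> dm {x, t} = 2"
      using x u N0 kN by (auto simp: dE_iff N_def)
  qed
  have int: "(L0 \<union> T) \<inter> insert x ?N0 = ?N0" using x_notin N0 by auto
  have un: "(L0 \<union> T) \<union> insert x ?N0 = L0 \<union> insert x T" using N0 by auto
  have edge: "b \<in> ?N0" if "{x, b} \<in> dE" for b
  proof -
    obtain t i where b: "b = (t, i)" by force
    have "{u, t} \<in> E" "t \<in> L" "i < kap t" using that by (auto simp: x b dE_iff dV_def)
    then have "t \<in> N" by (simp add: N_def)
    then show ?thesis using kN[of t] \<open>i < kap t\<close> b by auto
  qed
  have "root_closed D.AG (D.par (L0 \<union> T)) (D.par ((L0 \<union> T) \<union> insert x ?N0))"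
  proof (rule D.amalgam_par)
    show "L0 \<union> T \<subseteq> dV" using L0_sub insert by auto
    show "insert x ?N0 \<subseteq> dV" using N0 x u by auto
    fix a b assume e: "{a, b} \<in> dE" "a \<in> L0 \<union> T \<union> insert x ?N0" "b \<in> L0 \<union> T \<union> insert x ?N0"
    have "{b, a} \<in> dE" using e(1) by (simp add: insert_commute)
    then show "{a, b} \<subseteq> L0 \<union> T \<or> {a, b} \<subseteq> insert x ?N0"
      using e edge[of a] edge[of b] N0 by (cases "a = x"; cases "b = x") auto
  qed (simp_all only: int 1 2)
  then show ?case
    unfolding un using root_closed_trans[OF IH _ D.par_mono] by blast
qed

lemma finite_dV: "finite dV"
proof -
  have "dV = (SIGMA t:L. {..<kap t})" by (auto simp: dV_def)
  then show ?thesis using fin_L by simp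
qed

theorem cone_step:
  assumes rc: "\<And>u. u \<in> L \<Longrightarrow> root_closed AG (par {t \<in> L. {u, t} \<in> E}) (par L)"
  shows "root_closed AG (par L) (par (insert v L))"
proof (rule cone_root_closed)
  have "L0 \<union> (dV - L0) = dV" using L0_sub by auto
  then show "root_closed D.AG (D.par L0) (carrier D.AG)"
    using duplicates_root_closed[OF rc, of "dV - L0"] finite_dV D.carrier_eq_par by simp
qed

end

section \<open>Parabolic subgroups are root-closed\<close>

text \<open>The star of \<open>v\<close> may be all of \<open>S\<close>, so the induction hypothesis
  cannot be applied to it. \<open>cone_step\<close> asks only for root-closedness inside
  \<open>par L\<close>, and \<open>L\<close> has fewer vertices than \<open>S\<close>.\<close>

theorem (in even_artin) par_root_closed:
  assumes eafc: "\<And>a b c. {a, b} \<in> E \<Longrightarrow> {b, c} \<in> E \<Longrightarrow> {a, c} \<in> E \<Longrightarrow>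
        (m {a, b} = 2 \<and> m {b, c} = 2) \<or> (m {a, b} = 2 \<and> m {a, c} = 2) \<or> (m {b, c} = 2 \<and> m {a, c} = 2)"
    and "finite S" "S \<subseteq> V" "T \<subseteq> S"
  shows "root_closed AG (par T) (par S)"
  using assms(2-)
proof (induction "card S" arbitrary: S T rule: less_induct)
  case less
  show ?case
  proof (cases "T = S")
    case True
    then show ?thesis by (simp add: root_closed_def)
  next
    case False
    then obtain v where v: "v \<in> S" "v \<notin> T" using less.prems by auto
    define L where "L = {t \<in> S - {v}. {v, t} \<in> E}"
    have L: "L \<subseteq> S - {v}" by (auto simp: L_def)
    have c: "card (S - {v}) < card S" using card_Diff1_less[OF less.prems(1) v(1)] .
    then have cL: "card L < card S" using L less.prems card_mono[of "S - {v}" L] by simp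
    have fL: "finite L" using L less.prems finite_subset by fastforce
    have IH: "root_closed AG (par T') (par (S - {v}))" if "T' \<subseteq> S - {v}" for T'
      using less.hyps[OF c _ _ that] less.prems by auto
    interpret cone: eafc_cone V E m v L
      using eafc fL v less.prems by unfold_locales (auto simp: L_def)
    have rcL: "root_closed AG (par L) (par (insert v L))"
    proof (rule cone.cone_step)
      show "root_closed AG (par {t \<in> L. {u, t} \<in> E}) (par L)" for u
        using less.hyps[OF cL fL, of "{t \<in> L. {u, t} \<in> E}"] L less.prems by auto
    qed
    have int: "(S - {v}) \<inter> insert v L = L" using L by auto
    have un: "(S - {v}) \<union> insert v L = S" using L v by auto
    have "root_closed AG (par (S - {v})) (par ((S - {v}) \<union> insert v L))"
    proof (rule amalgam_par)
      show "S - {v} \<subseteq> V" "insert v L \<subseteq> V" using less.prems v L by auto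
      have nbr: "b \<in> insert v L" if "{v, b} \<in> E" "b \<in> S" for b
        using that by (cases "b = v") (simp_all add: L_def)
      fix a b assume ab: "{a, b} \<in> E" "a \<in> S - {v} \<union> insert v L" "b \<in> S - {v} \<union> insert v L"
      have "{b, a} \<in> E" using ab(1) by (simp only: insert_commute)
      moreover have "a \<in> S" "b \<in> S" using ab(2,3) unfolding un by blast+
      ultimately show "{a, b} \<subseteq> S - {v} \<or> {a, b} \<subseteq> insert v L"
        using nbr[of a] nbr[of b] ab(1) by blast
    qed (simp_all only: int IH[OF L] rcL)
    then have "root_closed AG (par (S - {v})) (par S)" by (simp only: un)
    moreover have "T \<subseteq> S - {v}" using v less.prems by auto
    ultimately show ?thesis using root_closed_trans[OF IH] par_mono by metis
  qed
qed

theorem theorem1p2: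
  fixes V :: "'v set" and E :: "'v set set" and m :: "'v set \<Rightarrow> nat"
    and g :: "'v word set" and n :: int
  assumes "eafc_system V E m" and "finite V"
    and "g \<in> carrier (artin_group V E m)" and "n \<noteq> 0"
  shows "parabolic_closure V E m {g} = parabolic_closure V E m {g [^]\<^bsub>artin_group V E m\<^esub> n}"
proof -
  interpret even_artin V E m
    using assms(1) by unfold_locales (auto simp: eafc_system_def)
  have eafc: "(m {a, b} = 2 \<and> m {b, c} = 2) \<or> (m {a, b} = 2 \<and> m {a, c} = 2) \<or> (m {b, c} = 2 \<and> m {a, c} = 2)"
    if "{a, b} \<in> E" "{b, c} \<in> E" "{a, c} \<in> E" for a b c
    using that assms(1) unfolding eafc_system_def by blast
  note g = assms(3)
  \<comment> \<open>Both closures are then intersections of the same family of parabolic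
    subgroups.\<close>
  have "g \<in> H \<longleftrightarrow> g [^]\<^bsub>AG\<^esub> n \<in> H" if "parabolic V E m H" for H
  proof -
    from that obtain S x where S: "S \<subseteq> V" and x: "x \<in> carrier AG"
      and H: "H = (\<lambda>h. x \<otimes>\<^bsub>AG\<^esub> h \<otimes>\<^bsub>AG\<^esub> inv\<^bsub>AG\<^esub> x) ` par S"
      using std_parabolic_eq_par unfolding parabolic_def by metis
    note sub = par_subgroup[OF S]
    have iff: "y \<in> H \<longleftrightarrow> inv\<^bsub>AG\<^esub> x \<otimes>\<^bsub>AG\<^esub> y \<otimes>\<^bsub>AG\<^esub> x \<in> par S" if "y \<in> carrier AG" for y
      unfolding H by (rule AG.subgroup_conj_image[OF x that subgroup.subset[OF sub]])
    define h where "h = inv\<^bsub>AG\<^esub> x \<otimes>\<^bsub>AG\<^esub> g \<otimes>\<^bsub>AG\<^esub> x"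
    have h: "h \<in> carrier AG" using x g by (simp add: h_def)
    have hpow: "inv\<^bsub>AG\<^esub> x \<otimes>\<^bsub>AG\<^esub> g [^]\<^bsub>AG\<^esub> k \<otimes>\<^bsub>AG\<^esub> x = h [^]\<^bsub>AG\<^esub> k" for k :: nat
      using AG.pow_conj[of "inv\<^bsub>AG\<^esub> x" g k] x g by (simp add: h_def)
    have inv_iff: "inv\<^bsub>AG\<^esub> y \<in> H \<longleftrightarrow> y \<in> H" if y: "y \<in> carrier AG" for y
    proof -
      have "inv\<^bsub>AG\<^esub> x \<otimes>\<^bsub>AG\<^esub> inv\<^bsub>AG\<^esub> y \<otimes>\<^bsub>AG\<^esub> x = inv\<^bsub>AG\<^esub> (inv\<^bsub>AG\<^esub> x \<otimes>\<^bsub>AG\<^esub> y \<otimes>\<^bsub>AG\<^esub> x)"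
        using x y by (simp add: AG.inv_mult_group AG.m_assoc)
      moreover have "inv\<^bsub>AG\<^esub> z \<in> par S \<longleftrightarrow> z \<in> par S" if "z \<in> carrier AG" for z
        using that sub by (metis AG.inv_inv subgroup.m_inv_closed)
      ultimately show ?thesis using iff x y by simp
    qed
    \<comment> \<open>By \<open>inv_iff\<close> the sign of \<open>n\<close> does not affect
      membership in \<open>H\<close>, so a positive exponent suffices.\<close>
    define k where "k = nat \<bar>n\<bar>"
    have k: "0 < k" using assms(4) by (simp add: k_def)
    have rc: "root_closed AG (par S) (carrier AG)"
      using par_root_closed[OF eafc assms(2) subset_refl S] by (simp add: carrier_eq_par)
    have "h [^]\<^bsub>AG\<^esub> k \<in> par S \<longleftrightarrow> h \<in> par S"
      using root_closedD[OF rc h k] AG.subgroup_int_pow_closed[OF sub, of h "int k"]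
      by (auto simp: int_pow_int)
    then have "g [^]\<^bsub>AG\<^esub> k \<in> H \<longleftrightarrow> g \<in> H"
      using iff g hpow by (simp add: h_def)
    moreover have "g [^]\<^bsub>AG\<^esub> n = g [^]\<^bsub>AG\<^esub> k \<or> g [^]\<^bsub>AG\<^esub> n = inv\<^bsub>AG\<^esub> (g [^]\<^bsub>AG\<^esub> k)"
    proof (cases "n < 0")
      case True
      then have "n = - int k" by (simp add: k_def)
      then show ?thesis using AG.int_pow_neg_int[OF g, of k] by simp
    next
      case False
      then have "n = int k" by (simp add: k_def)
      then show ?thesis by (simp add: int_pow_int)
    qed
    ultimately show ?thesis using inv_iff[of "g [^]\<^bsub>AG\<^esub> k"] g by auto
  qed
  then have "{H. parabolic V E m H \<and> {g} \<subseteq> H} = {H. parabolic V E m H \<and> {g [^]\<^bsub>AG\<^esub> n} \<subseteq> H}"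
    by blast
  then show ?thesis by (simp only: parabolic_closure_def)
qed

end
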